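(* Consider the linear quadratic dynamic game with strategically robust costs $J^i$ described in the context. Let the matrices $P_t^i\in\mathbb{R}^{n\times n}$, $i=1,\dots,N$, be defined by the backward Riccati recursion $$ \begin{aligned} P^i_t &= Q^i_t + (K^{i}_t)^\top R^i_t K^i_t - (L^{i}_t)^\top S^i_t L^i_t - (L^i_t - K^{-i}_t)^\top M^i_t (L^i_t - K^{-i}_t)\\ &\quad + (A_t+B_t^iK_t^i+B_t^{-i}L_t^i)^\top P^i_{t+1} (A_t+B_t^iK_t^i+B_t^{-i}L_t^i),\qquad t=T-1,\dots,0, \end{aligned} $$ initialized with $P_T^i=Q_T^i$, where the gains $K_t^i\in\mathbb{R}^{d_i\times n}$ and $L_t^i\in\mathbb{R}^{(\sum_{j\ne i}d_j)\times n}$ are given by $$ \begin{bmatrix} K_t^1\\ L_t^1\\ \vdots\\ K_t^N\\ L_t^N\end{bmatrix} = H_t^{-1}\begin{bmatrix} G_t^{u^1}\\ G_t^{d^1}\\ \vdots\\ G_t^{u^N}\\ G_t^{d^N}\end{bmatrix}, $$ and where $K_t^{-i}$ denotes the vertical stacking of the $K_t^j$, $j\neq i$. Here $$ \begin{aligned} H_t^{u^i,u^i} &= R_t^i + (B_t^i)^\top P_{t+1}^i B_t^i, & H_t^{u^i,d^i} &= (B_t^i)^\top P_{t+1}^i B_t^{-i},\\ H_t^{d^i,d^i} &= M_t^i + S_t^i - (B_t^{-i})^\top P_{t+1}^i B_t^{-i}, & H_t^{d^i,u^i} &= -(B_t^{-i})^\top P_{t+1}^i B_t^{i},\\ G_t^{u^i}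 &= -(B_t^i)^\top P_{t+1}^i A_t, & G_t^{d^i} &= (B_t^{-i})^\top P_{t+1}^i A_t, \end{aligned} $$ and $H_t$ is the square block matrix whose block rows and block columns are both indexed by $u^1,d^1,\dots,u^N,d^N$ (in this order), with - block row $u^i$: $H_t^{u^i,u^i}$ in column $u^i$, $H_t^{u^i,d^i}$ in column $d^i$, and $0$ in all other columns; - block row $d^i$: $H_t^{d^i,u^i}$ in column $u^i$, $H_t^{d^i,d^i}$ in column $d^i$, $-M_t^{i,j}$ in column $u^j$ for each $j\ne i$, and $0$ in column $d^j$ for each $j\neq i$, where $M_t^{i,j}$ is the submatrix of $M_t^i$ formed by the $d_j$ columns associated with player $j$. Suppose that $H_t^{u^i,u^i}\succ 0$ and $H_t^{d^i,d^i}\succ 0$ for all players $i$, and that the matrix $H_t$ is invertible, at all times $t\in\{0,\dots,T-1\}$. Consider the linear and Markovian feedback policies $$\bar\pi_t^i(x_t)=K_t^i x_t .$$ Then $(\bar\pi^1,\dots,\bar\pi^N)$ is a strategically robust dynamic equilibrium of the game, and it is the unique subgame perfect strategically robust dynamic equilibrium. Moreover, for each player $i$, the optimal adversarial feedback policy $\sigma^i$ (i.e., the maximizer in the definition of $J^i(\bar\pi^i,\bar\pi^{-i})$) is uniquely given by $\bar\sigma_t^i(x_t)=L_t^i x_t$.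
   Context: **Game.** There are $N$ players, a finite horizon $T\in\mathbb{N}_{>0}$, a state $x_t\in\mathbb{R}^n$ with given initial condition $x_0\in\mathbb{R}^n$, and inputs $u_t^i\in\mathbb{R}^{d_i}$ of player $i$. The system evolves as $x_{t+1}=A_tx_t+\sum_{j=1}^N B_t^j u_t^j$, with matrices $A_t$, $B_t^j$ of appropriate dimensions. The cost matrices are symmetric and satisfy $Q_t^i\succeq 0$ ($t=0,\dots,T$), $R_t^i\succ0$, $S_t^i\succeq0$, $M_t^i\succ0$ ($t=0,\dots,T-1$); $S_t^i$ and $M_t^i$ have size $\sum_{j\ne i}d_j$. Write $\|x\|_Q^2=x^\top Qx$. **Notation.** $B_t^{-i}$ is the horizontal stacking of the $B_t^j$, $j\neq i$; $u_t^{-i}$ is the vertical stacking of the $u_t^j$, $j\ne i$; $\pi^{-i}=(\pi^j)_{j\ne i}$ (all with the same ordering of the players $j\neq i$). **Policies.** $\Pi^i$ is the set of state-feedback policies $\pi^i=(\pi_t^i)_{t=0}^{T-1}$ of player $i$, where $\pi_t^i$ is a measurable function of $(x_0,\dots,x_t)$ with values in $\mathbb{R}^{d_i}$. $\Sigma^i$ is the set of policies $\sigma^i=(\sigma_t^i)_{t=0}^{T-1}$ of a fictitious adversary of player $i$, where $\sigma_t^i$ is a measurable function of $(x_0,\dots,x_t)$ with values in $\mathbb{R}^{\sum_{j\ne i}d_j}$. **Strategically robust cost.** For $\pi^i\in\Pi^i$ and $\pi^{-i}\in\prod_{j\ne i}\Pi^j$, $$ J^i(\pi^i,\pi^{-i})=\max_{\sigma^i\in\Sigma^i}\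 \|x_T\|^2_{Q_T^i}+\sum_{t=0}^{T-1}\Big(\|x_t\|^2_{Q_t^i}+\|u_t^i\|^2_{R_t^i}-\|d_t^i\|^2_{S_t^i}-\|d_t^i-u_t^{-i}\|^2_{M_t^i}\Big) $$ subject to the worst-case dynamics $x_{t+1}=A_tx_t+B_t^iu_t^i+B_t^{-i}d_t^i$ started at $x_0$, with $u_t^i=\pi_t^i(x_0,\dots,x_t)$, $u_t^j=\pi_t^j(x_0,\dots,x_t)$ for $j\ne i$, and $d_t^i=\sigma_t^i(x_0,\dots,x_t)$. **Equilibrium.** A tuple $(\bar\pi^1,\dots,\bar\pi^N)\in\Pi^1\times\dots\times\Pi^N$ is a strategically robust dynamic equilibrium if, for all players $i$, $J^i(\bar\pi^i,\bar\pi^{-i})\le J^i(\pi^i,\bar\pi^{-i})$ for all $\pi^i\in\Pi^i$. It is subgame perfect (in the usual sense) if, for every time $t$ and every history $(x_0,\dots,x_t)$, the continuation policies form a strategically robust dynamic equilibrium of the game restricted to stages $t,\dots,T$ following that history.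
   Formalization: Literal uniqueness of the maximizing adversary policy fails, since its values at unreached histories do not affect the payoff; it is stated as: every maximizer equals L_t x_t along its own trajectory (also in each subgame), and a policy maximizing after every history equals L_t x_t at all histories. *)

theory Defs
  imports
    "HOL-Analysis.Finite_Product_Measure"
    "Jordan_Normal_Form.Gauss_Jordan_Elimination"
begin

unbundle no vec_syntax and no inner_syntax

definition quad :: "real mat \<Rightarrow> real vec \<Rightarrow> real" where
  "quad Q x = x \<bullet> (Q *\<^sub>v x)"

definition pos_semidef :: "nat \<Rightarrow> real mat \<Rightarrow> bool" where
  "pos_semidef m Q \<longleftrightarrow> Q \<in> carrier_mat m m \<and> transpose_mat Q = Q \<and>
     (\<forall>x\<in>carrier_vec m. 0 \<le> quad Q x)"

definition pos_def :: "nat \<Rightarrow> real mat \<Rightarrow> bool" where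
  "pos_def m Q \<longleftrightarrow> Q \<in> carrier_mat m m \<and> transpose_mat Q = Q \<and>
     (\<forall>x\<in>carrier_vec m. x \<noteq> 0\<^sub>v m \<longrightarrow> 0 < quad Q x)"

definition hstack :: "nat \<Rightarrow> real mat list \<Rightarrow> real mat" where
  "hstack nr Bs = mat_of_cols nr (concat (map cols Bs))"

definition vstack :: "nat \<Rightarrow> real mat list \<Rightarrow> real mat" where
  "vstack nc Bs = mat_of_rows nc (concat (map rows Bs))"

definition vstack_vec :: "real vec list \<Rightarrow> real vec" where
  "vstack_vec us = vec_of_list (concat (map list_of_vec us))"

text \<open>The type of vectors carries no topology, so the Borel sets of \<open>\<real>\<^sup>m\<close> are those of the
  product \<open>\<real> \<times> \<dots> \<times> \<real>\<close>, transported along the coordinate map.\<close>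

definition vec_borel :: "nat \<Rightarrow> real vec measure" where
  "vec_borel m = vimage_algebra (carrier_vec m) (\<lambda>v. \<lambda>k\<in>{..<m}. v $ k)
     (Pi\<^sub>M {..<m} (\<lambda>_. borel))"

text \<open>Players are numbered \<open>0, \<dots>, players G - 1\<close>. The first argument of the matrix-valued fields
  is the time, the second one (if any) the player.\<close>

record lq_game =
  players :: nat
  horizon :: nat
  state_dim :: nat
  input_dim :: "nat \<Rightarrow> nat"
  A_mat :: "nat \<Rightarrow> real mat"
  B_mat :: "nat \<Rightarrow> nat \<Rightarrow> real mat"
  Q_mat :: "nat \<Rightarrow> nat \<Rightarrow> real mat"
  R_mat :: "nat \<Rightarrow> nat \<Rightarrow> real mat"
  S_mat :: "nat \<Rightarrow> nat \<Rightarrow> real mat"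
  M_mat :: "nat \<Rightarrow> nat \<Rightarrow> real mat"

definition others :: "lq_game \<Rightarrow> nat \<Rightarrow> nat list" where
  "others G i = filter (\<lambda>j. j \<noteq> i) [0..<players G]"

definition adv_dim :: "lq_game \<Rightarrow> nat \<Rightarrow> nat" where
  "adv_dim G i = (\<Sum>j\<in>{..<players G} - {i}. input_dim G j)"

definition well_formed :: "lq_game \<Rightarrow> bool" where
  "well_formed G \<longleftrightarrow>
     0 < horizon G \<and>
     (\<forall>t<horizon G. A_mat G t \<in> carrier_mat (state_dim G) (state_dim G)) \<and>
     (\<forall>t<horizon G. \<forall>i<players G. B_mat G t i \<in> carrier_mat (state_dim G) (input_dim G i)) \<and>
     (\<forall>t\<le>horizon G. \<forall>i<players G. pos_semidef (state_dim G) (Q_mat G t i)) \<and>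
     (\<forall>t<horizon G. \<forall>i<players G.
        pos_def (input_dim G i) (R_mat G t i) \<and>
        pos_semidef (adv_dim G i) (S_mat G t i) \<and>
        pos_def (adv_dim G i) (M_mat G t i))"

definition B_others :: "lq_game \<Rightarrow> nat \<Rightarrow> nat \<Rightarrow> real mat" where
  "B_others G t i = hstack (state_dim G) (map (B_mat G t) (others G i))"

text \<open>A history \<open>(x\<^sub>0, \<dots>, x\<^sub>t)\<close> is an element of \<open>{..t} \<rightarrow>\<^sub>E carrier_vec n\<close>; a policy maps
  a time \<open>t\<close> and a history up to time \<open>t\<close> to an input.\<close>

type_synonym history = "nat \<Rightarrow> real vec"
type_synonym policy = "nat \<Rightarrow> history \<Rightarrow> real vec"

definition feedback_policies :: "lq_game \<Rightarrow> nat \<Rightarrow> policy set" where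
  "feedback_policies G m =
     {\<pi>. \<forall>t<horizon G. \<pi> t \<in> measurable (Pi\<^sub>M {..t} (\<lambda>_. vec_borel (state_dim G))) (vec_borel m)}"

definition policies :: "lq_game \<Rightarrow> nat \<Rightarrow> policy set" where
  "policies G i = feedback_policies G (input_dim G i)"

definition adv_policies :: "lq_game \<Rightarrow> nat \<Rightarrow> policy set" where
  "adv_policies G i = feedback_policies G (adv_dim G i)"

definition histories :: "lq_game \<Rightarrow> real vec \<Rightarrow> nat \<Rightarrow> history set" where
  "histories G x0 t = {h \<in> {..t} \<rightarrow>\<^sub>E carrier_vec (state_dim G). h 0 = x0}"

definition others_input :: "lq_game \<Rightarrow> nat \<Rightarrow> (nat \<Rightarrow> policy) \<Rightarrow> nat \<Rightarrow> history \<Rightarrow> real vec" where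
  "others_input G i \<pi> t h = vstack_vec (map (\<lambda>j. \<pi> j t h) (others G i))"

text \<open>\<open>worst_hist G i \<pi> \<sigma> t h k\<close> is the history up to time \<open>t + k\<close> that arises when the history
  up to time \<open>t\<close> is \<open>h\<close> and, from then on, player \<open>i\<close> uses \<open>\<pi> i\<close> and the fictitious adversary
  of player \<open>i\<close> uses \<open>\<sigma>\<close>.\<close>

primrec worst_hist ::
  "lq_game \<Rightarrow> nat \<Rightarrow> (nat \<Rightarrow> policy) \<Rightarrow> policy \<Rightarrow> nat \<Rightarrow> history \<Rightarrow> nat \<Rightarrow> history" where
  "worst_hist G i \<pi> \<sigma> t h 0 = restrict h {..t}"
| "worst_hist G i \<pi> \<sigma> t h (Suc k) =
     (let y = worst_hist G i \<pi> \<sigma> t h k; s = t + k in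
      y(Suc s := A_mat G s *\<^sub>v y s + B_mat G s i *\<^sub>v \<pi> i s y + B_others G s i *\<^sub>v \<sigma> s y))"

definition stage_cost ::
  "lq_game \<Rightarrow> nat \<Rightarrow> (nat \<Rightarrow> policy) \<Rightarrow> policy \<Rightarrow> nat \<Rightarrow> history \<Rightarrow> real" where
  "stage_cost G i \<pi> \<sigma> s y =
     quad (Q_mat G s i) (y s) + quad (R_mat G s i) (\<pi> i s y)
     - quad (S_mat G s i) (\<sigma> s y) - quad (M_mat G s i) (\<sigma> s y - others_input G i \<pi> s y)"

definition adv_payoff ::
  "lq_game \<Rightarrow> nat \<Rightarrow> (nat \<Rightarrow> policy) \<Rightarrow> nat \<Rightarrow> history \<Rightarrow> policy \<Rightarrow> real" where
  "adv_payoff G i \<pi> t h \<sigma> =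
     quad (Q_mat G (horizon G) i) (worst_hist G i \<pi> \<sigma> t h (horizon G - t) (horizon G)) +
     (\<Sum>s = t..<horizon G. stage_cost G i \<pi> \<sigma> s (worst_hist G i \<pi> \<sigma> t h (s - t)))"

text \<open>Cost of player \<open>i\<close> in the game restricted to the stages \<open>t, \<dots>, horizon G\<close> following the
  history \<open>h\<close>. For arbitrary \<open>\<pi>\<close> the maximum over the adversary need not be attained, and may be
  infinite; it is read as a supremum in the extended reals.\<close>

definition robust_cost ::
  "lq_game \<Rightarrow> nat \<Rightarrow> (nat \<Rightarrow> policy) \<Rightarrow> nat \<Rightarrow> history \<Rightarrow> ereal" where
  "robust_cost G i \<pi> t h = (SUP \<sigma>\<in>adv_policies G i. ereal (adv_payoff G i \<pi> t h \<sigma>))"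

definition optimal_adv ::
  "lq_game \<Rightarrow> nat \<Rightarrow> (nat \<Rightarrow> policy) \<Rightarrow> nat \<Rightarrow> history \<Rightarrow> policy \<Rightarrow> bool" where
  "optimal_adv G i \<pi> t h = is_arg_max (adv_payoff G i \<pi> t h) (\<lambda>\<sigma>. \<sigma> \<in> adv_policies G i)"

text \<open>Only the values of policies at histories extending \<open>h\<close> enter the costs below, and
  every continuation policy extends to a policy of the whole game, so continuation policies can be
  represented by policies of the whole game.\<close>

definition equilibrium_after ::
  "lq_game \<Rightarrow> nat \<Rightarrow> history \<Rightarrow> (nat \<Rightarrow> policy) \<Rightarrow> bool" where
  "equilibrium_after G t h \<pi> \<longleftrightarrow>
     (\<forall>i<players G. \<pi> i \<in> policies G i) \<and>
     (\<forall>i<players G. \<forall>\<rho>\<in>policies G i. robust_cost G i \<pi> t h \<le> robust_cost G i (\<pi>(i := \<rho>)) t h)"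

definition initial_history :: "real vec \<Rightarrow> history" where
  "initial_history x0 = (\<lambda>_\<in>{..0}. x0)"

definition equilibrium :: "lq_game \<Rightarrow> real vec \<Rightarrow> (nat \<Rightarrow> policy) \<Rightarrow> bool" where
  "equilibrium G x0 \<pi> \<longleftrightarrow> equilibrium_after G 0 (initial_history x0) \<pi>"

definition subgame_perfect :: "lq_game \<Rightarrow> real vec \<Rightarrow> (nat \<Rightarrow> policy) \<Rightarrow> bool" where
  "subgame_perfect G x0 \<pi> \<longleftrightarrow>
     (\<forall>t\<le>horizon G. \<forall>h\<in>histories G x0 t. equilibrium_after G t h \<pi>)"

text \<open>In the definitions from \<open>H_uu\<close> to \<open>riccati_step\<close>, the argument \<open>P\<close> stands for the family
  \<open>(P\<^sup>i)\<^sub>i\<close> at time \<open>t + 1\<close>.\<close>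

definition H_uu :: "lq_game \<Rightarrow> nat \<Rightarrow> (nat \<Rightarrow> real mat) \<Rightarrow> nat \<Rightarrow> real mat" where
  "H_uu G t P i = R_mat G t i + transpose_mat (B_mat G t i) * P i * B_mat G t i"

definition H_ud :: "lq_game \<Rightarrow> nat \<Rightarrow> (nat \<Rightarrow> real mat) \<Rightarrow> nat \<Rightarrow> real mat" where
  "H_ud G t P i = transpose_mat (B_mat G t i) * P i * B_others G t i"

definition H_dd :: "lq_game \<Rightarrow> nat \<Rightarrow> (nat \<Rightarrow> real mat) \<Rightarrow> nat \<Rightarrow> real mat" where
  "H_dd G t P i = M_mat G t i + S_mat G t i - transpose_mat (B_others G t i) * P i * B_others G t i"

definition H_du :: "lq_game \<Rightarrow> nat \<Rightarrow> (nat \<Rightarrow> real mat) \<Rightarrow> nat \<Rightarrow> real mat" where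
  "H_du G t P i = - (transpose_mat (B_others G t i) * P i * B_mat G t i)"

definition G_u :: "lq_game \<Rightarrow> nat \<Rightarrow> (nat \<Rightarrow> real mat) \<Rightarrow> nat \<Rightarrow> real mat" where
  "G_u G t P i = - (transpose_mat (B_mat G t i) * P i * A_mat G t)"

definition G_d :: "lq_game \<Rightarrow> nat \<Rightarrow> (nat \<Rightarrow> real mat) \<Rightarrow> nat \<Rightarrow> real mat" where
  "G_d G t P i = transpose_mat (B_others G t i) * P i * A_mat G t"

definition M_sub :: "lq_game \<Rightarrow> nat \<Rightarrow> nat \<Rightarrow> nat \<Rightarrow> real mat" where
  "M_sub G t i j = mat (adv_dim G i) (input_dim G j)
     (\<lambda>(r, c). M_mat G t i $$ (r, (\<Sum>l\<in>{..<j} - {i}. input_dim G l) + c))"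

definition pair_dim :: "lq_game \<Rightarrow> nat \<Rightarrow> nat" where
  "pair_dim G i = input_dim G i + adv_dim G i"

definition H_block :: "lq_game \<Rightarrow> nat \<Rightarrow> (nat \<Rightarrow> real mat) \<Rightarrow> nat \<Rightarrow> nat \<Rightarrow> real mat" where
  \<comment> \<open>the rows \<open>u\<^sup>i\<close>, \<open>d\<^sup>i\<close> and columns \<open>u\<^sup>j\<close>, \<open>d\<^sup>j\<close> of \<open>H\<close>\<close>
  "H_block G t P i j =
     (if j = i then four_block_mat (H_uu G t P i) (H_ud G t P i) (H_du G t P i) (H_dd G t P i)
      else four_block_mat
        (0\<^sub>m (input_dim G i) (input_dim G j)) (0\<^sub>m (input_dim G i) (adv_dim G j))
        (- M_sub G t i j)                     (0\<^sub>m (adv_dim G i) (adv_dim G j)))"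

definition H_mat :: "lq_game \<Rightarrow> nat \<Rightarrow> (nat \<Rightarrow> real mat) \<Rightarrow> real mat" where
  "H_mat G t P =
     vstack (\<Sum>j<players G. pair_dim G j)
       (map (\<lambda>i. hstack (pair_dim G i) (map (H_block G t P i) [0..<players G])) [0..<players G])"

definition G_stack :: "lq_game \<Rightarrow> nat \<Rightarrow> (nat \<Rightarrow> real mat) \<Rightarrow> real mat" where
  "G_stack G t P =
     vstack (state_dim G) (concat (map (\<lambda>i. [G_u G t P i, G_d G t P i]) [0..<players G]))"

definition gain_stack :: "lq_game \<Rightarrow> nat \<Rightarrow> (nat \<Rightarrow> real mat) \<Rightarrow> real mat" where
  "gain_stack G t P = the (mat_inverse (H_mat G t P)) * G_stack G t P"

definition K_of :: "lq_game \<Rightarrow> nat \<Rightarrow> (nat \<Rightarrow> real mat) \<Rightarrow> nat \<Rightarrow> real mat" where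
  "K_of G t P i = mat (input_dim G i) (state_dim G)
     (\<lambda>(r, c). gain_stack G t P $$ ((\<Sum>l<i. pair_dim G l) + r, c))"

definition L_of :: "lq_game \<Rightarrow> nat \<Rightarrow> (nat \<Rightarrow> real mat) \<Rightarrow> nat \<Rightarrow> real mat" where
  "L_of G t P i = mat (adv_dim G i) (state_dim G)
     (\<lambda>(r, c). gain_stack G t P $$ ((\<Sum>l<i. pair_dim G l) + input_dim G i + r, c))"

definition K_others_of :: "lq_game \<Rightarrow> nat \<Rightarrow> (nat \<Rightarrow> real mat) \<Rightarrow> nat \<Rightarrow> real mat" where
  "K_others_of G t P i = vstack (state_dim G) (map (K_of G t P) (others G i))"

definition riccati_step :: "lq_game \<Rightarrow> nat \<Rightarrow> (nat \<Rightarrow> real mat) \<Rightarrow> nat \<Rightarrow> real mat" where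
  "riccati_step G t P i =
     (let K = K_of G t P i; L = L_of G t P i; D = L - K_others_of G t P i;
          F = A_mat G t + B_mat G t i * K + B_others G t i * L
      in Q_mat G t i + transpose_mat K * R_mat G t i * K - transpose_mat L * S_mat G t i * L
         - transpose_mat D * M_mat G t i * D + transpose_mat F * P i * F)"

primrec riccati_to_go :: "lq_game \<Rightarrow> nat \<Rightarrow> nat \<Rightarrow> real mat" where
  "riccati_to_go G 0 = Q_mat G (horizon G)"
| "riccati_to_go G (Suc k) = riccati_step G (horizon G - Suc k) (riccati_to_go G k)"

definition P_mat :: "lq_game \<Rightarrow> nat \<Rightarrow> nat \<Rightarrow> real mat" where
  "P_mat G t = riccati_to_go G (horizon G - t)"

definition K_mat :: "lq_game \<Rightarrow> nat \<Rightarrow> nat \<Rightarrow> real mat" where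
  "K_mat G t i = K_of G t (P_mat G (Suc t)) i"

definition L_mat :: "lq_game \<Rightarrow> nat \<Rightarrow> nat \<Rightarrow> real mat" where
  "L_mat G t i = L_of G t (P_mat G (Suc t)) i"

definition K_policy :: "lq_game \<Rightarrow> nat \<Rightarrow> policy" where
  "K_policy G i t h = K_mat G t i *\<^sub>v h t"

definition L_policy :: "lq_game \<Rightarrow> nat \<Rightarrow> policy" where
  "L_policy G i t h = L_mat G t i *\<^sub>v h t"

end

theory Submission
  imports Defs "Jordan_Normal_Form.Determinant"
begin

text \<open>
  Fix a player \<open>i\<close> and a time \<open>t\<close>, and suppose that from time \<open>t + 1\<close> on everybody plays the Riccati
  gains, so that the remaining cost is \<open>\<parallel>x\<parallel>\<^sup>2\<close> in the metric \<open>P\<close> of player \<open>i\<close> at time \<open>t + 1\<close>. What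
  is left is a one-stage zero-sum game between the input \<open>u\<close> and the adversarial input \<open>d\<close>, whose
  payoff is quadratic in \<open>(u, d)\<close>, with (up to a factor \<open>2\<close>) Hessian blocks \<open>H\<^sup>u\<^sup>u\<close> in \<open>u\<close> and \<open>- H\<^sup>d\<^sup>d\<close> in \<open>d\<close>. It is
  therefore strictly convex in \<open>u\<close> and strictly concave in \<open>d\<close>, a stationary point is the same as a
  saddle point, and \<open>u\<close> minimizes the maximum over \<open>d\<close> exactly if \<open>u\<close> together with its worst case \<open>d\<close>
  is stationary. Everything follows from the exact second-order expansion \<open>stage_val_expand\<close>.

  The players are coupled only because the adversary of \<open>i\<close> is penalized for leaving the actual
  inputs of the others. Collecting the stationarity conditions of all players gives precisely the
  linear system with matrix \<open>H\<close> (\<open>H_system_iff_stationary\<close>). As \<open>H\<close> is invertible, its only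
  solution at the state \<open>x\<close> is given by the gains, and the value of the resulting saddle point is the
  quadratic form of the Riccati update (\<open>riccati_value\<close>).

  Existence: induction over the remaining stages turns the two saddle inequalities into
  \<open>payoff_le_value\<close> (no adversary gains more than the value against the gains \<open>K\<close>, and an adversary
  gaining that much uses \<open>L\<close> along its path) and \<open>payoff_ge_value\<close> (no deviation of player \<open>i\<close> does
  better than the value against the adversary \<open>L\<close>).
  Together they make the gains optimal in every subgame.

  Uniqueness: by backward induction a subgame perfect equilibrium agrees with the gains after time
  \<open>t\<close>. At a history at time \<open>t\<close> the robust cost of changing only the input at time \<open>t\<close> is then the
  maximum over \<open>d\<close> of the one-stage payoff (\<open>robust_cost_one_stage\<close>). Optimality of every player
  gives the stationarity conditions of every player, hence the linear system, hence the gains.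
\<close>

section \<open>Stacked vectors and matrices\<close>

lemma vec_of_list_append: "vec_of_list (xs @ ys) = vec_of_list xs @\<^sub>v vec_of_list ys"
  by (metis list_of_vec_append list_vec vec_list)

lemma vstack_vec_Nil [simp]: "vstack_vec [] = vNil"
  by (simp add: vstack_vec_def)

lemma vstack_vec_append: "vstack_vec (us @ vs) = vstack_vec us @\<^sub>v vstack_vec vs"
  by (simp add: vstack_vec_def vec_of_list_append)

lemma vstack_vec_Cons [simp]: "vstack_vec (u # us) = u @\<^sub>v vstack_vec us"
  using vstack_vec_append[of "[u]" us] by (simp add: vstack_vec_def vec_list)

lemma dim_vstack_vec [simp]: "dim_vec (vstack_vec us) = (\<Sum>u\<leftarrow>us. dim_vec u)"
  by (induction us) auto

text \<open>A stack determines its blocks as soon as the block sizes are fixed; this is how block equations are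
  read off an equation between stacks.\<close>

lemma vstack_vec_map_eq_iff:
  assumes "\<And>j. j \<in> set js \<Longrightarrow> dim_vec (u j) = dim_vec (w j)"
  shows "vstack_vec (map u js) = vstack_vec (map w js) \<longleftrightarrow> (\<forall>j\<in>set js. u j = w j)"
  using assms
proof (induction js)
  case (Cons j js)
  have "u j \<in> carrier_vec (dim_vec (w j))" "w j \<in> carrier_vec (dim_vec (w j))"
    using Cons.prems[of j] by (auto intro: carrier_vecI)
  then have "u j @\<^sub>v vstack_vec (map u js) = w j @\<^sub>v vstack_vec (map w js)
      \<longleftrightarrow> u j = w j \<and> vstack_vec (map u js) = vstack_vec (map w js)"
    by (rule append_vec_eq)
  moreover have "vstack_vec (map u js) = vstack_vec (map w js) \<longleftrightarrow> (\<forall>j\<in>set js. u j = w j)"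
    using Cons.prems by (intro Cons.IH) auto
  ultimately show ?case by (simp del: append_vec_eq)
qed simp

lemma scalar_prod_vstack_vec:
  fixes u w :: "'i \<Rightarrow> real vec"
  assumes "\<And>j. j \<in> set js \<Longrightarrow> dim_vec (u j) = dim_vec (w j)"
  shows "vstack_vec (map u js) \<bullet> vstack_vec (map w js) = (\<Sum>j\<leftarrow>js. u j \<bullet> w j)"
  using assms
proof (induction js)
  case (Cons j js)
  have "(\<Sum>k\<leftarrow>js. dim_vec (u k)) = (\<Sum>k\<leftarrow>js. dim_vec (w k))"
    using Cons.prems by (intro arg_cong[of _ _ sum_list] map_cong) auto
  then have "vstack_vec (map u js) \<in> carrier_vec (\<Sum>k\<leftarrow>js. dim_vec (w k))"
    "vstack_vec (map w js) \<in> carrier_vec (\<Sum>k\<leftarrow>js. dim_vec (w k))"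
    by (auto intro!: carrier_vecI simp: comp_def)
  moreover have "u j \<in> carrier_vec (dim_vec (w j))" "w j \<in> carrier_vec (dim_vec (w j))"
    using Cons.prems[of j] by (auto intro: carrier_vecI)
  ultimately have "(u j @\<^sub>v vstack_vec (map u js)) \<bullet> (w j @\<^sub>v vstack_vec (map w js))
      = u j \<bullet> w j + vstack_vec (map u js) \<bullet> vstack_vec (map w js)"
    by (intro scalar_prod_append)
  moreover have "vstack_vec (map u js) \<bullet> vstack_vec (map w js) = (\<Sum>j\<leftarrow>js. u j \<bullet> w j)"
    using Cons.prems by (intro Cons.IH) auto
  ultimately show ?case by simp
qed simp

lemma sum_list_filter_upt:
  "(\<Sum>j\<leftarrow>filter p [0..<n]. f j) = (\<Sum>j\<in>{j\<in>{..<n}. p j}. f j)" for f :: "nat \<Rightarrow> 'a::comm_monoid_add"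
  by (subst sum_list_distinct_conv_sum_set) (auto intro!: sum.cong)

text \<open>The gains and the column blocks of \<open>M\<close> are cut out of a larger matrix by offsets, which are sums
  of block sizes over the preceding indices, possibly with one player left out. The filter \<open>p\<close>
  serves both cases.\<close>

lemma vec_eq_vstack_vec_blocks:
  assumes "w \<in> carrier_vec (\<Sum>j\<leftarrow>filter p [0..<n]. d j)"
  shows "w = vstack_vec (map (\<lambda>j. vec (d j) (\<lambda>r. w $ ((\<Sum>l\<in>{l\<in>{..<j}. p l}. d l) + r)))
    (filter p [0..<n]))"
  using assms
proof (induction n arbitrary: w)
  case 0
  then show ?case by auto
next
  case (Suc n)
  let ?block = "\<lambda>w j. vec (d j) (\<lambda>r. w $ ((\<Sum>l\<in>{l\<in>{..<j}. p l}. d l) + r))"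
  define D where "D = (\<Sum>l\<in>{l\<in>{..<n}. p l}. d l)"
  show ?case
  proof (cases "p n")
    case False
    then show ?thesis using Suc by simp
  next
    case True
    define w1 where "w1 = vec D (\<lambda>r. w $ r)"
    have dim: "dim_vec w = D + d n"
      using Suc.prems True by (simp add: D_def sum_list_filter_upt)
    have split: "w = w1 @\<^sub>v ?block w n"
      by (rule eq_vecI) (auto simp: w1_def dim D_def)
    \<comment> \<open>the earlier blocks end before position \<open>D\<close>, so they are not affected by the cut\<close>
    have block: "?block w1 j = ?block w j" if "j \<in> set (filter p [0..<n])" for j
    proof -
      have "(\<Sum>l\<in>{l\<in>{..<j}. p l}. d l) + d j = (\<Sum>l\<in>insert j {l\<in>{..<j}. p l}. d l)"
        by simp
      also have "\<dots> \<le> D"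
        unfolding D_def using that by (intro sum_mono2) auto
      finally show ?thesis by (auto simp: w1_def)
    qed
    have "w1 \<in> carrier_vec (\<Sum>j\<leftarrow>filter p [0..<n]. d j)"
      by (intro carrier_vecI) (simp add: w1_def D_def sum_list_filter_upt)
    then have "w1 = vstack_vec (map (?block w1) (filter p [0..<n]))"
      by (rule Suc.IH)
    also have "\<dots> = vstack_vec (map (?block w) (filter p [0..<n]))"
      using block by (intro arg_cong[of _ _ vstack_vec] map_cong) auto
    finally have w1: "w1 = \<dots>" .
    have "vstack_vec (map (?block w) (filter p [0..<Suc n]))
        = vstack_vec (map (?block w) (filter p [0..<n])) @\<^sub>v (?block w n @\<^sub>v vNil)"
      using True by (simp add: vstack_vec_append)
    also have "\<dots> = w1 @\<^sub>v ?block w n"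
      unfolding w1[symmetric] by (auto intro!: eq_vecI)
    finally show ?thesis using split by simp
  qed
qed

lemma row_hstack:
  assumes "\<And>B. B \<in> set Bs \<Longrightarrow> dim_row B = nr" "r < nr"
  shows "row (hstack nr Bs) r = vstack_vec (map (\<lambda>B. row B r) Bs)"
proof -
  have "row (hstack nr Bs) r = vec_of_list (map (\<lambda>c. c $ r) (concat (map cols Bs)))"
    using assms(2) by (intro eq_vecI)
      (auto simp: hstack_def vec_of_list_index mat_of_cols_def simp del: vec_of_list_map)
  also have "map (\<lambda>c. c $ r) (concat (map cols Bs)) = concat (map (\<lambda>B. list_of_vec (row B r)) Bs)"
    using assms by (induction Bs) (auto intro!: nth_equalityI simp: list_of_vec_index)
  finally show ?thesis by (simp add: vstack_vec_def comp_def del: vec_of_list_map)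
qed

lemma dim_hstack [simp]:
  "dim_row (hstack nr Bs) = nr" "dim_col (hstack nr Bs) = (\<Sum>B\<leftarrow>Bs. dim_col B)"
  by (auto simp: hstack_def length_concat comp_def)

lemma dim_vstack [simp]:
  "dim_row (vstack nc Bs) = (\<Sum>B\<leftarrow>Bs. dim_row B)" "dim_col (vstack nc Bs) = nc"
  by (auto simp: vstack_def length_concat comp_def)

lemma hstack_mult_vstack_vec:
  assumes B: "\<And>j. j \<in> set js \<Longrightarrow> B j \<in> carrier_mat nr (dim_vec (u j))" and r: "r < nr"
  shows "(hstack nr (map B js) *\<^sub>v vstack_vec (map u js)) $ r = (\<Sum>j\<leftarrow>js. (B j *\<^sub>v u j) $ r)"
proof -
  have "(hstack nr (map B js) *\<^sub>v vstack_vec (map u js)) $ r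
      = vstack_vec (map (\<lambda>j. row (B j) r) js) \<bullet> vstack_vec (map u js)"
    using B r by (subst index_mult_mat_vec, simp, subst row_hstack) (auto simp: comp_def)
  also have "\<dots> = (\<Sum>j\<leftarrow>js. row (B j) r \<bullet> u j)"
    using B by (intro scalar_prod_vstack_vec) auto
  also have "\<dots> = (\<Sum>j\<leftarrow>js. (B j *\<^sub>v u j) $ r)"
  proof (intro arg_cong[of _ _ sum_list] map_cong refl)
    fix j assume "j \<in> set js"
    then have "dim_row (B j) = nr" using B by blast
    then show "row (B j) r \<bullet> u j = (B j *\<^sub>v u j) $ r" using r by simp
  qed
  finally show ?thesis .
qed

lemma vstack_mult_vec:
  assumes "\<And>B. B \<in> set Bs \<Longrightarrow> dim_col B = nc"
  shows "vstack nc Bs *\<^sub>v x = vstack_vec (map (\<lambda>B. B *\<^sub>v x) Bs)"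
proof -
  have rows: "set (concat (map rows Bs)) \<subseteq> carrier_vec nc"
    using assms by (auto simp: rows_def intro!: carrier_vecI)
  have "vstack nc Bs *\<^sub>v x = vec_of_list (map (\<lambda>r. r \<bullet> x) (concat (map rows Bs)))"
  proof (rule eq_vecI)
    fix i assume "i < dim_vec (vec_of_list (map (\<lambda>r. r \<bullet> x) (concat (map rows Bs))))"
    then have i: "i < length (concat (map rows Bs))"
      by (simp del: vec_of_list_map)
    then have "concat (map rows Bs) ! i \<in> carrier_vec nc"
      using rows nth_mem by blast
    then show "(vstack nc Bs *\<^sub>v x) $ i = vec_of_list (map (\<lambda>r. r \<bullet> x) (concat (map rows Bs))) $ i"
      using i by (simp add: vstack_def vec_of_list_index del: vec_of_list_map)
  qed (simp add: vstack_def del: vec_of_list_map)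
  also have "map (\<lambda>r. r \<bullet> x) (concat (map rows Bs)) = concat (map (\<lambda>B. list_of_vec (B *\<^sub>v x)) Bs)"
    by (induction Bs) (auto intro!: nth_equalityI simp: list_of_vec_index)
  finally show ?thesis by (simp add: vstack_vec_def comp_def del: vec_of_list_map)
qed

section \<open>Quadratic forms\<close>

lemma scalar_prod_transpose_mult:
  assumes "A \<in> carrier_mat m k" "x \<in> carrier_vec k" "y \<in> carrier_vec m"
  shows "x \<bullet> (transpose_mat A *\<^sub>v y) = (A *\<^sub>v x) \<bullet> (y :: real vec)"
proof -
  have "x \<bullet> (transpose_mat A *\<^sub>v y) = (transpose_mat A *\<^sub>v y) \<bullet> x"
    using assms by (intro comm_scalar_prod[of _ k]) auto
  also have "\<dots> = y \<bullet> (A *\<^sub>v x)"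
    using assms by (intro transpose_vec_mult_scalar) auto
  also have "\<dots> = (A *\<^sub>v x) \<bullet> y"
    using assms by (intro comm_scalar_prod[of _ m]) auto
  finally show ?thesis .
qed

lemma quad_add:
  assumes "Q \<in> carrier_mat m m" "transpose_mat Q = Q" "x \<in> carrier_vec m" "y \<in> carrier_vec m"
  shows "quad Q (x + y) = quad Q x + 2 * (y \<bullet> (Q *\<^sub>v x)) + quad Q y"
proof -
  have Q: "Q *\<^sub>v x \<in> carrier_vec m" "Q *\<^sub>v y \<in> carrier_vec m" using assms by auto
  have "x \<bullet> (Q *\<^sub>v y) = (Q *\<^sub>v x) \<bullet> y"
    using scalar_prod_transpose_mult[of Q m m x y] assms by simp
  also have "\<dots> = y \<bullet> (Q *\<^sub>v x)"
    using assms by (intro comm_scalar_prod[of _ m]) auto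
  finally have "x \<bullet> (Q *\<^sub>v y) = y \<bullet> (Q *\<^sub>v x)" .
  then show ?thesis
    unfolding quad_def mult_add_distrib_mat_vec[OF assms(1,3,4)]
    by (simp add: add_scalar_prod_distrib[OF assms(3,4)] Q
        scalar_prod_add_distrib[OF assms(3) Q] scalar_prod_add_distrib[OF assms(4) Q])
qed

lemma quad_smult:
  assumes "Q \<in> carrier_mat m m" "x \<in> carrier_vec m"
  shows "quad Q (c \<cdot>\<^sub>v x) = c\<^sup>2 * quad Q x"
  using assms by (simp add: quad_def mult_mat_vec[of Q m m] power2_eq_square)

lemma quad_congruence:
  assumes "F \<in> carrier_mat m k" "P \<in> carrier_mat m m" "x \<in> carrier_vec k"
  shows "quad (transpose_mat F * P * F) x = quad P (F *\<^sub>v x)"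
proof -
  have "(transpose_mat F * P * F) *\<^sub>v x = transpose_mat F *\<^sub>v (P *\<^sub>v (F *\<^sub>v x))"
    using assms assoc_mult_mat_vec[of "transpose_mat F * P" k m F k x]
      assoc_mult_mat_vec[of "transpose_mat F" k m P m "F *\<^sub>v x"] by simp
  then show ?thesis
    using assms scalar_prod_transpose_mult[of F m k x "P *\<^sub>v (F *\<^sub>v x)"] by (simp add: quad_def)
qed

lemma quad_add_mat:
  assumes "P \<in> carrier_mat m m" "Q \<in> carrier_mat m m" "x \<in> carrier_vec m"
  shows "quad (P + Q) x = quad P x + quad Q x"
  using assms
  by (simp add: quad_def add_mult_distrib_mat_vec[of _ m m] scalar_prod_add_distrib[of _ m])

lemma quad_minus_mat:
  assumes "P \<in> carrier_mat m m" "Q \<in> carrier_mat m m" "x \<in> carrier_vec m"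
  shows "quad (P - Q) x = quad P x - quad Q x"
  using assms
  by (simp add: quad_def minus_mult_distrib_mat_vec[of _ m m] scalar_prod_minus_distrib[of _ m])

lemma symmetric_congruence:
  assumes "F \<in> carrier_mat m k" "P \<in> carrier_mat m m" "transpose_mat P = P"
  shows "transpose_mat (transpose_mat F * P * F) = transpose_mat F * P * (F :: real mat)"
proof -
  have "transpose_mat (transpose_mat F * P * F) = transpose_mat F * transpose_mat (transpose_mat F * P)"
    using assms by (intro transpose_mult[of _ k m]) auto
  also have "transpose_mat (transpose_mat F * P) = P * F"
    using assms transpose_mult[of "transpose_mat F" k m P m] by simp
  finally show ?thesis
    using assms by (simp add: assoc_mult_mat[of _ k m _ m])
qed

text \<open>A positive definite matrix has trivial kernel, so its determinant is nonzero.\<close>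

lemma pos_def_imp_solvable:
  assumes "pos_def m H" "b \<in> carrier_vec m"
  obtains x where "x \<in> carrier_vec m" "H *\<^sub>v x = b"
proof -
  have H: "H \<in> carrier_mat m m" using assms by (simp add: pos_def_def)
  have "det H \<noteq> 0"
    using assms det_0_iff_vec_prod_zero[OF H] by (fastforce simp: pos_def_def quad_def)
  then have "H \<in> Units (ring_mat TYPE(real) m ())"
    using H by (intro det_non_zero_imp_unit)
  then obtain X where X: "mat_inverse H = Some X"
    using mat_inverse(1)[OF H, of "()"] by (cases "mat_inverse H") auto
  then have "H *\<^sub>v (X *\<^sub>v b) = b" "X *\<^sub>v b \<in> carrier_vec m"
    using mat_inverse(2)[OF H X] assms H
    by (auto simp: assoc_mult_mat_vec[of H m m X m, symmetric])
  then show thesis using that by blast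
qed

section \<open>One stage against the adversary\<close>

text \<open>One stage of the game of a single player: \<open>u\<close> is the input of the player, \<open>d\<close> that of the
  adversary, \<open>v\<close> the inputs that the other players really use, and \<open>P\<close> the quadratic form of the
  cost to go at the successor state. Positive definiteness is assumed only in an extension
  below, since the expansion is pure algebra.\<close>

locale one_stage_game =
  fixes n p m :: nat and A B C Q R S M P :: "real mat"
  assumes A: "A \<in> carrier_mat n n"
    and B: "B \<in> carrier_mat n p"
    and C: "C \<in> carrier_mat n m"
    and Q: "Q \<in> carrier_mat n n"
    and R: "R \<in> carrier_mat p p" "transpose_mat R = R"
    and S: "S \<in> carrier_mat m m" "transpose_mat S = S"
    and M: "M \<in> carrier_mat m m" "transpose_mat M = M"
    and P: "P \<in> carrier_mat n n" "transpose_mat P = P"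
begin

definition Huu where "Huu = R + transpose_mat B * P * B"
definition Hud where "Hud = transpose_mat B * P * C"
definition Hdd where "Hdd = M + S - transpose_mat C * P * C"
definition Hdu where "Hdu = - (transpose_mat C * P * B)"
definition Gu where "Gu = - (transpose_mat B * P * A)"
definition Gd where "Gd = transpose_mat C * P * A"

definition step :: "real vec \<Rightarrow> real vec \<Rightarrow> real vec \<Rightarrow> real vec" where
  "step x u d = A *\<^sub>v x + B *\<^sub>v u + C *\<^sub>v d"

definition stage_val :: "real vec \<Rightarrow> real vec \<Rightarrow> real vec \<Rightarrow> real vec \<Rightarrow> real" where
  "stage_val x v u d = quad Q x + quad R u - quad S d - quad M (d - v) + quad P (step x u d)"

text \<open>Up to the factors \<open>2\<close> and \<open>-2\<close>, these are the equations that the partial gradients of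
  \<open>stage_val x v\<close> with respect to \<open>u\<close> and \<open>d\<close> vanish.\<close>

definition stationary_u :: "real vec \<Rightarrow> real vec \<Rightarrow> real vec \<Rightarrow> bool" where
  "stationary_u x u d \<longleftrightarrow> Huu *\<^sub>v u + Hud *\<^sub>v d = Gu *\<^sub>v x"

definition stationary_d :: "real vec \<Rightarrow> real vec \<Rightarrow> real vec \<Rightarrow> real vec \<Rightarrow> bool" where
  "stationary_d x v u d \<longleftrightarrow> Hdu *\<^sub>v u + Hdd *\<^sub>v d - M *\<^sub>v v = Gd *\<^sub>v x"

lemma coefficients_carrier [simp]:
  "Huu \<in> carrier_mat p p" "Hud \<in> carrier_mat p m" "Hdd \<in> carrier_mat m m"
  "Hdu \<in> carrier_mat m p" "Gu \<in> carrier_mat p n" "Gd \<in> carrier_mat m n"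
  using A B C R S M P unfolding Huu_def Hud_def Hdd_def Hdu_def Gu_def Gd_def by auto

lemma congruence_mult:
  assumes "E \<in> carrier_mat n k" "F \<in> carrier_mat n l" "a \<in> carrier_vec k" "b \<in> carrier_vec l"
  shows "a \<bullet> ((transpose_mat E * P * F) *\<^sub>v b) = (E *\<^sub>v a) \<bullet> (P *\<^sub>v (F *\<^sub>v b))"
proof -
  have "(transpose_mat E * P * F) *\<^sub>v b = transpose_mat E *\<^sub>v (P *\<^sub>v (F *\<^sub>v b))"
    using assms P assoc_mult_mat_vec[of "transpose_mat E * P" k n F l b]
      assoc_mult_mat_vec[of "transpose_mat E" k n P n "F *\<^sub>v b"] by simp
  then show ?thesis
    using assms P scalar_prod_transpose_mult[of E n k a "P *\<^sub>v (F *\<^sub>v b)"] by simp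
qed

lemma P_symmetric: "a \<in> carrier_vec n \<Longrightarrow> b \<in> carrier_vec n \<Longrightarrow> a \<bullet> (P *\<^sub>v b) = b \<bullet> (P *\<^sub>v a)"
  using scalar_prod_transpose_mult[of P n n a b] P comm_scalar_prod[of b n "P *\<^sub>v a"] by simp

text \<open>The Taylor expansion of the payoff at \<open>(u, d)\<close>; it is exact because the payoff is quadratic.\<close>

lemma stage_val_expand:
  assumes x: "x \<in> carrier_vec n" and u: "u \<in> carrier_vec p" "a \<in> carrier_vec p"
    and d: "v \<in> carrier_vec m" "d \<in> carrier_vec m" "b \<in> carrier_vec m"
  shows "stage_val x v (u + a) (d + b) = stage_val x v u d
    + 2 * (a \<bullet> (Huu *\<^sub>v u + Hud *\<^sub>v d - Gu *\<^sub>v x))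
    - 2 * (b \<bullet> (Hdu *\<^sub>v u + Hdd *\<^sub>v d - M *\<^sub>v v - Gd *\<^sub>v x))
    + quad Huu a + 2 * (a \<bullet> (Hud *\<^sub>v b)) - quad Hdd b"
proof -
  let ?y = "step x u d" and ?Ba = "B *\<^sub>v a" and ?Cb = "C *\<^sub>v b"
  have n [simp]: "A *\<^sub>v x \<in> carrier_vec n" "B *\<^sub>v u \<in> carrier_vec n" "C *\<^sub>v d \<in> carrier_vec n"
    "?Ba \<in> carrier_vec n" "?Cb \<in> carrier_vec n" "?y \<in> carrier_vec n"
    using A B C x u d by (auto simp: step_def)
  have Pn [simp]: "P *\<^sub>v w \<in> carrier_vec n" if "w \<in> carrier_vec n" for w
    using P that by simp
  have step: "step x (u + a) (d + b) = ?y + (?Ba + ?Cb)"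
    unfolding step_def mult_add_distrib_mat_vec[OF B u] mult_add_distrib_mat_vec[OF C d(2,3)]
    by (rule eq_vecI) (use A B C in auto)
  have Py: "w \<bullet> (P *\<^sub>v ?y) = w \<bullet> (P *\<^sub>v (A *\<^sub>v x)) + w \<bullet> (P *\<^sub>v (B *\<^sub>v u)) + w \<bullet> (P *\<^sub>v (C *\<^sub>v d))"
    if "w \<in> carrier_vec n" for w
    unfolding step_def using that P
    by (simp add: mult_add_distrib_mat_vec[of P n n] scalar_prod_add_distrib[of w n])
  have "quad P (step x (u + a) (d + b)) = quad P ?y + 2 * ((?Ba + ?Cb) \<bullet> (P *\<^sub>v ?y)) + quad P (?Ba + ?Cb)"
    unfolding step using P by (intro quad_add) auto
  also have "quad P (?Ba + ?Cb) = quad P ?Ba + 2 * (?Ba \<bullet> (P *\<^sub>v ?Cb)) + quad P ?Cb"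
    using P by (subst quad_add) (auto simp: P_symmetric[of ?Cb ?Ba])
  also have "(?Ba + ?Cb) \<bullet> (P *\<^sub>v ?y) = ?Ba \<bullet> (P *\<^sub>v ?y) + ?Cb \<bullet> (P *\<^sub>v ?y)"
    by (intro add_scalar_prod_distrib[of _ n]) auto
  finally have qP: "quad P (step x (u + a) (d + b)) = quad P ?y
     + 2 * (?Ba \<bullet> (P *\<^sub>v (A *\<^sub>v x)) + ?Ba \<bullet> (P *\<^sub>v (B *\<^sub>v u)) + ?Ba \<bullet> (P *\<^sub>v (C *\<^sub>v d)))
     + 2 * (?Cb \<bullet> (P *\<^sub>v (A *\<^sub>v x)) + ?Cb \<bullet> (P *\<^sub>v (B *\<^sub>v u)) + ?Cb \<bullet> (P *\<^sub>v (C *\<^sub>v d)))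
     + quad P ?Ba + 2 * (?Ba \<bullet> (P *\<^sub>v ?Cb)) + quad P ?Cb"
    by (simp add: Py)
  have qR: "quad R (u + a) = quad R u + 2 * (a \<bullet> (R *\<^sub>v u)) + quad R a"
    using R u by (intro quad_add)
  have qS: "quad S (d + b) = quad S d + 2 * (b \<bullet> (S *\<^sub>v d)) + quad S b"
    using S d by (intro quad_add)
  have "d + b - v = (d - v) + b" using d by (intro eq_vecI) auto
  then have qM: "quad M (d + b - v) = quad M (d - v) + 2 * (b \<bullet> (M *\<^sub>v d) - b \<bullet> (M *\<^sub>v v)) + quad M b"
    using M d quad_add[of M m "d - v" b]
    by (simp add: mult_minus_distrib_mat_vec[of M m m] scalar_prod_minus_distrib[of b m])
  have cong: "transpose_mat B * P * B \<in> carrier_mat p p" "transpose_mat C * P * C \<in> carrier_mat m m"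
    "transpose_mat C * P * B \<in> carrier_mat m p" "transpose_mat B * P * A \<in> carrier_mat p n"
    using A B C P by auto
  have gu: "a \<bullet> (Huu *\<^sub>v u + Hud *\<^sub>v d - Gu *\<^sub>v x) = a \<bullet> (R *\<^sub>v u) + ?Ba \<bullet> (P *\<^sub>v (B *\<^sub>v u))
      + ?Ba \<bullet> (P *\<^sub>v (C *\<^sub>v d)) + ?Ba \<bullet> (P *\<^sub>v (A *\<^sub>v x))"
  proof -
    have "a \<bullet> (Huu *\<^sub>v u + Hud *\<^sub>v d - Gu *\<^sub>v x) = a \<bullet> (Huu *\<^sub>v u) + a \<bullet> (Hud *\<^sub>v d) - a \<bullet> (Gu *\<^sub>v x)"
      using u d x mult_mat_vec_carrier[OF coefficients_carrier(1) u(1)] mult_mat_vec_carrier[OF coefficients_carrier(2) d(2)]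
        mult_mat_vec_carrier[OF coefficients_carrier(5) x]
      by (simp add: scalar_prod_minus_distrib[of a p] scalar_prod_add_distrib[of a p])
    moreover have "a \<bullet> (Huu *\<^sub>v u) = a \<bullet> (R *\<^sub>v u) + ?Ba \<bullet> (P *\<^sub>v (B *\<^sub>v u))"
      using u R(1) cong(1) congruence_mult[OF B B u(2,1)]
        mult_mat_vec_carrier[OF R(1) u(1)] mult_mat_vec_carrier[OF cong(1) u(1)]
      unfolding Huu_def
      by (simp only: add_mult_distrib_mat_vec[of R p p] scalar_prod_add_distrib[of a p])
    moreover have "a \<bullet> (Hud *\<^sub>v d) = ?Ba \<bullet> (P *\<^sub>v (C *\<^sub>v d))"
      unfolding Hud_def by (rule congruence_mult[OF B C u(2) d(2)])
    moreover have "a \<bullet> (Gu *\<^sub>v x) = - (?Ba \<bullet> (P *\<^sub>v (A *\<^sub>v x)))"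
    proof -
      have "Gu *\<^sub>v x = - ((transpose_mat B * P * A) *\<^sub>v x)"
        unfolding Gu_def using cong(4) x A by (intro uminus_mult_mat_vec) auto
      moreover have "a \<bullet> - ((transpose_mat B * P * A) *\<^sub>v x) = - (a \<bullet> ((transpose_mat B * P * A) *\<^sub>v x))"
        using u B by (intro scalar_prod_uminus_right) auto
      ultimately show ?thesis using congruence_mult[OF B A u(2) x] by simp
    qed
    ultimately show ?thesis by linarith
  qed
  have gd: "b \<bullet> (Hdu *\<^sub>v u + Hdd *\<^sub>v d - M *\<^sub>v v - Gd *\<^sub>v x) = b \<bullet> (M *\<^sub>v d) + b \<bullet> (S *\<^sub>v d)
      - ?Cb \<bullet> (P *\<^sub>v (C *\<^sub>v d)) - ?Cb \<bullet> (P *\<^sub>v (B *\<^sub>v u)) - b \<bullet> (M *\<^sub>v v) - ?Cb \<bullet> (P *\<^sub>v (A *\<^sub>v x))"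
    and qHdd: "quad Hdd b = quad M b + quad S b - quad P ?Cb"
  proof -
    have c: "Hdu *\<^sub>v u \<in> carrier_vec m" "Hdd *\<^sub>v d \<in> carrier_vec m" "M *\<^sub>v v \<in> carrier_vec m"
      "Gd *\<^sub>v x \<in> carrier_vec m"
      using u d x M mult_mat_vec_carrier[OF coefficients_carrier(4) u(1)] mult_mat_vec_carrier[OF coefficients_carrier(3) d(2)]
        mult_mat_vec_carrier[OF coefficients_carrier(6) x] by auto
    have "b \<bullet> (Hdu *\<^sub>v u + Hdd *\<^sub>v d - M *\<^sub>v v - Gd *\<^sub>v x)
        = b \<bullet> (Hdu *\<^sub>v u) + b \<bullet> (Hdd *\<^sub>v d) - b \<bullet> (M *\<^sub>v v) - b \<bullet> (Gd *\<^sub>v x)"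
      using d c by (simp add: scalar_prod_minus_distrib[of b m] scalar_prod_add_distrib[of b m])
    moreover have Hdd: "b \<bullet> (Hdd *\<^sub>v w) = b \<bullet> (M *\<^sub>v w) + b \<bullet> (S *\<^sub>v w) - ?Cb \<bullet> (P *\<^sub>v (C *\<^sub>v w))"
      if w: "w \<in> carrier_vec m" for w
    proof -
      have "Hdd *\<^sub>v w = M *\<^sub>v w + S *\<^sub>v w - (transpose_mat C * P * C) *\<^sub>v w"
        unfolding Hdd_def using M S cong(2) w
        by (simp only: minus_mult_distrib_mat_vec[of "M + S" m m] add_mult_distrib_mat_vec[of M m m] add_carrier_mat)
      moreover have "b \<bullet> (M *\<^sub>v w + S *\<^sub>v w - (transpose_mat C * P * C) *\<^sub>v w)
          = b \<bullet> (M *\<^sub>v w) + b \<bullet> (S *\<^sub>v w) - b \<bullet> ((transpose_mat C * P * C) *\<^sub>v w)"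
        using d mult_mat_vec_carrier[OF M(1) w] mult_mat_vec_carrier[OF S(1) w]
          mult_mat_vec_carrier[OF cong(2) w]
        by (simp only: scalar_prod_minus_distrib[of b m] scalar_prod_add_distrib[of b m] add_carrier_vec)
      ultimately show ?thesis using congruence_mult[OF C C d(3) w] by simp
    qed
    moreover have "b \<bullet> (Gd *\<^sub>v x) = ?Cb \<bullet> (P *\<^sub>v (A *\<^sub>v x))"
      unfolding Gd_def by (rule congruence_mult[OF C A d(3) x])
    moreover have "b \<bullet> (Hdu *\<^sub>v u) = - (?Cb \<bullet> (P *\<^sub>v (B *\<^sub>v u)))"
    proof -
      have "Hdu *\<^sub>v u = - ((transpose_mat C * P * B) *\<^sub>v u)"
        unfolding Hdu_def using cong(3) u B by (intro uminus_mult_mat_vec) auto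
      moreover have "b \<bullet> - ((transpose_mat C * P * B) *\<^sub>v u) = - (b \<bullet> ((transpose_mat C * P * B) *\<^sub>v u))"
        using d C by (intro scalar_prod_uminus_right) auto
      ultimately show ?thesis using congruence_mult[OF C B d(3) u(1)] by simp
    qed
    ultimately show "b \<bullet> (Hdu *\<^sub>v u + Hdd *\<^sub>v d - M *\<^sub>v v - Gd *\<^sub>v x) = b \<bullet> (M *\<^sub>v d) + b \<bullet> (S *\<^sub>v d)
      - ?Cb \<bullet> (P *\<^sub>v (C *\<^sub>v d)) - ?Cb \<bullet> (P *\<^sub>v (B *\<^sub>v u)) - b \<bullet> (M *\<^sub>v v) - ?Cb \<bullet> (P *\<^sub>v (A *\<^sub>v x))"
      using d(2) by simp
    show "quad Hdd b = quad M b + quad S b - quad P ?Cb"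
      using Hdd[OF d(3)] by (simp add: quad_def)
  qed
  have qHuu: "quad Huu a = quad R a + quad P ?Ba"
    unfolding Huu_def quad_add_mat[OF R(1) cong(1) u(2)] quad_congruence[OF B P(1) u(2)] ..
  have Hud: "a \<bullet> (Hud *\<^sub>v b) = ?Ba \<bullet> (P *\<^sub>v ?Cb)"
    unfolding Hud_def by (rule congruence_mult[OF B C u(2) d(3)])
  show ?thesis
    unfolding stage_val_def qP qR qS qM gu gd qHuu Hud qHdd by simp
qed

lemma residual_carrier:
  assumes "x \<in> carrier_vec n" "u \<in> carrier_vec p" "d \<in> carrier_vec m" "v \<in> carrier_vec m"
  shows "Huu *\<^sub>v u + Hud *\<^sub>v d \<in> carrier_vec p" "Gu *\<^sub>v x \<in> carrier_vec p"
    "Hdu *\<^sub>v u + Hdd *\<^sub>v d - M *\<^sub>v v \<in> carrier_vec m" "Gd *\<^sub>v x \<in> carrier_vec m"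
  using assms coefficients_carrier M
  by (auto intro!: add_carrier_vec minus_carrier_vec mult_mat_vec_carrier simp del: coefficients_carrier)

text \<open>Stationarity in \<open>d\<close> removes the linear term in \<open>b\<close>. The linear term in \<open>a\<close> stays, because this form
  is used both at saddle points and at points whose stationarity in \<open>u\<close> is still to be shown.\<close>

lemma stage_val_at_stationary_d:
  assumes "x \<in> carrier_vec n" "u \<in> carrier_vec p" "a \<in> carrier_vec p"
    and "v \<in> carrier_vec m" "d \<in> carrier_vec m" "b \<in> carrier_vec m"
    and "stationary_d x v u d"
  shows "stage_val x v (u + a) (d + b) = stage_val x v u d
    + 2 * (a \<bullet> (Huu *\<^sub>v u + Hud *\<^sub>v d - Gu *\<^sub>v x))
    + quad Huu a + 2 * (a \<bullet> (Hud *\<^sub>v b)) - quad Hdd b"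
proof -
  have "Hdu *\<^sub>v u + Hdd *\<^sub>v d - M *\<^sub>v v - Gd *\<^sub>v x = 0\<^sub>v m"
    using assms residual_carrier(4)[of x u d v] by (simp add: stationary_d_def)
  then show ?thesis
    using stage_val_expand[OF assms(1-6)] assms(6) by simp
qed

lemma mult_zero_mat_vec: "E \<in> carrier_mat k l \<Longrightarrow> E *\<^sub>v 0\<^sub>v l = 0\<^sub>v k"
  for E :: "real mat"
  by (intro eq_vecI) auto

lemma quad_zero [simp]: "E \<in> carrier_mat k k \<Longrightarrow> quad E (0\<^sub>v k) = 0"
  by (simp add: quad_def)

lemma stage_val_deviate_u:
  assumes "x \<in> carrier_vec n" "u \<in> carrier_vec p" "u' \<in> carrier_vec p"
    and "v \<in> carrier_vec m" "d \<in> carrier_vec m"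
    and "stationary_d x v u d" "stationary_u x u d"
  shows "stage_val x v u' d = stage_val x v u d + quad Huu (u' - u)"
proof -
  have "Huu *\<^sub>v u + Hud *\<^sub>v d - Gu *\<^sub>v x = 0\<^sub>v p"
    using assms residual_carrier(2)[of x u d v] by (simp add: stationary_u_def)
  moreover have "u + (u' - u) = u'" "d + 0\<^sub>v m = d" using assms by auto
  moreover have "Hud *\<^sub>v 0\<^sub>v m = 0\<^sub>v p"
    using mult_zero_mat_vec[OF coefficients_carrier(2)] .
  ultimately show ?thesis
    using stage_val_at_stationary_d[of x u "u' - u" v d "0\<^sub>v m"] assms by simp
qed

lemma stage_val_deviate_d:
  assumes "x \<in> carrier_vec n" "u \<in> carrier_vec p"
    and "v \<in> carrier_vec m" "d \<in> carrier_vec m" "d' \<in> carrier_vec m"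
    and "stationary_d x v u d"
  shows "stage_val x v u d' = stage_val x v u d - quad Hdd (d' - d)"
proof -
  have "d + (d' - d) = d'" "u + 0\<^sub>v p = u" using assms by auto
  moreover have "Hud *\<^sub>v (d' - d) \<in> carrier_vec p"
    using assms by (intro mult_mat_vec_carrier[OF coefficients_carrier(2)]) auto
  moreover have "Huu *\<^sub>v u + Hud *\<^sub>v d - Gu *\<^sub>v x \<in> carrier_vec p"
    using residual_carrier[of x u d v] assms by auto
  ultimately show ?thesis
    using stage_val_at_stationary_d[of x u "0\<^sub>v p" v d "d' - d"] assms by simp
qed

end

text \<open>With linear feedbacks \<open>K\<close>, \<open>L\<close>, and \<open>V\<close> for the other players, the stage payoff is a quadratic form
  in the state, whose matrix is the right-hand side of the Riccati recursion.\<close>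

lemma (in one_stage_game) stage_val_feedback:
  assumes x: "x \<in> carrier_vec n" and K: "K \<in> carrier_mat p n"
    and L: "L \<in> carrier_mat m n" and V: "V \<in> carrier_mat m n"
  shows "quad (Q + transpose_mat K * R * K - transpose_mat L * S * L
      - transpose_mat (L - V) * M * (L - V)
      + transpose_mat (A + B * K + C * L) * P * (A + B * K + C * L)) x
    = stage_val x (V *\<^sub>v x) (K *\<^sub>v x) (L *\<^sub>v x)"
proof -
  let ?F = "A + B * K + C * L"
  have F: "?F \<in> carrier_mat n n" and D: "L - V \<in> carrier_mat m n"
    using A B C K L V by auto
  have "?F *\<^sub>v x = (A + B * K) *\<^sub>v x + (C * L) *\<^sub>v x"
    using A B C K L x by (intro add_mult_distrib_mat_vec) auto
  also have "(A + B * K) *\<^sub>v x = A *\<^sub>v x + (B * K) *\<^sub>v x"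
    using A B K x by (intro add_mult_distrib_mat_vec) auto
  finally have Fx: "?F *\<^sub>v x = step x (K *\<^sub>v x) (L *\<^sub>v x)"
    unfolding step_def assoc_mult_mat_vec[OF B K x] assoc_mult_mat_vec[OF C L x] .
  have Dx: "(L - V) *\<^sub>v x = L *\<^sub>v x - V *\<^sub>v x"
    using L V x by (rule minus_mult_distrib_mat_vec)
  have c: "transpose_mat K * R * K \<in> carrier_mat n n" "transpose_mat L * S * L \<in> carrier_mat n n"
    "transpose_mat (L - V) * M * (L - V) \<in> carrier_mat n n" "transpose_mat ?F * P * ?F \<in> carrier_mat n n"
    using K L D F R(1) S(1) M(1) P(1) by (auto intro!: mult_carrier_mat)
  have c1: "Q + transpose_mat K * R * K \<in> carrier_mat n n"
    using Q c by auto
  have c2: "Q + transpose_mat K * R * K - transpose_mat L * S * L \<in> carrier_mat n n"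
    using c by (intro minus_carrier_mat)
  then have c3: "Q + transpose_mat K * R * K - transpose_mat L * S * L
      - transpose_mat (L - V) * M * (L - V) \<in> carrier_mat n n"
    using c by (intro minus_carrier_mat)
  show ?thesis
    unfolding stage_val_def quad_add_mat[OF c3 c(4) x] quad_minus_mat[OF c2 c(3) x]
      quad_minus_mat[OF c1 c(2) x] quad_add_mat[OF Q c(1) x]
      quad_congruence[OF K R(1) x] quad_congruence[OF L S(1) x] quad_congruence[OF D M(1) x]
      quad_congruence[OF F P(1) x] Fx Dx ..
qed

text \<open>First-order condition for a minimum at \<open>s = 0\<close> of a parabola whose curvature has unknown sign.\<close>

lemma nonneg_quadratic_imp_linear_zero:
  fixes r c :: real
  assumes nonneg: "\<And>s. 0 \<le> 2 * s * r + s\<^sup>2 * c"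
  shows "r = 0"
proof -
  let ?k = "\<bar>c\<bar> + 1"
  \<comment> \<open>at \<open>s = - r / ?k\<close> the linear term outweighs the quadratic one\<close>
  have "2 * (- (r / ?k)) * r + (- (r / ?k))\<^sup>2 * c = r\<^sup>2 / ?k * (c / ?k - 2)"
    by (simp add: power2_eq_square algebra_simps)
  then have "0 \<le> r\<^sup>2 / ?k * (c / ?k - 2)"
    using nonneg[of "- (r / ?k)"] by simp
  moreover have "c / ?k - 2 < 0"
  proof -
    have "0 < ?k" "c < 2 * ?k" using abs_ge_self[of c] abs_ge_zero[of c] by argo+
    then show ?thesis using pos_divide_less_eq[of ?k c 2] by simp
  qed
  ultimately have "r\<^sup>2 / ?k \<le> 0"
    by (metis linorder_not_le mult_pos_neg)
  then show ?thesis
    using abs_ge_zero[of c] by (auto simp: divide_le_0_iff)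
qed

locale saddle_stage_game = one_stage_game +
  assumes Huu_pos_def: "pos_def p Huu"
    and Hdd_pos_def: "pos_def m Hdd"
begin

lemma ex_stationary_d:
  assumes "x \<in> carrier_vec n" "u \<in> carrier_vec p" "v \<in> carrier_vec m"
  obtains d where "d \<in> carrier_vec m" "stationary_d x v u d"
proof -
  let ?b = "Gd *\<^sub>v x + M *\<^sub>v v - Hdu *\<^sub>v u"
  have c: "Gd *\<^sub>v x \<in> carrier_vec m" "M *\<^sub>v v \<in> carrier_vec m" "Hdu *\<^sub>v u \<in> carrier_vec m"
    using assms M mult_mat_vec_carrier[OF coefficients_carrier(4)]
      mult_mat_vec_carrier[OF coefficients_carrier(6)] by auto
  then have "?b \<in> carrier_vec m" by auto
  then obtain d where d: "d \<in> carrier_vec m" "Hdd *\<^sub>v d = ?b"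
    using pos_def_imp_solvable[OF Hdd_pos_def] by blast
  have "Hdu *\<^sub>v u + ?b - M *\<^sub>v v = Gd *\<^sub>v x"
  proof -
    have "a + (b + w - a) - w = b"
      if "a \<in> carrier_vec m" "b \<in> carrier_vec m" "w \<in> carrier_vec m" for a b w :: "real vec"
      using that by (intro eq_vecI) auto
    then show ?thesis using c by blast
  qed
  then have "stationary_d x v u d"
    unfolding stationary_d_def d(2) .
  with d(1) show thesis using that by blast
qed

lemma deviate_d_le:
  assumes "x \<in> carrier_vec n" "u \<in> carrier_vec p"
    and "v \<in> carrier_vec m" "d \<in> carrier_vec m" "d' \<in> carrier_vec m"
    and "stationary_d x v u d"
  shows "stage_val x v u d' \<le> stage_val x v u d"
    and "stage_val x v u d' = stage_val x v u d \<Longrightarrow> d' = d"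
proof -
  have c: "d' - d \<in> carrier_vec m" using assms by auto
  have *: "0 \<le> quad Hdd (d' - d)" "quad Hdd (d' - d) = 0 \<Longrightarrow> d' - d = 0\<^sub>v m"
    using Hdd_pos_def c quad_zero[OF coefficients_carrier(3)] unfolding pos_def_def
    by (metis order_less_imp_le order_refl, metis less_irrefl)
  have d': "d' = d + (d' - d)" using assms by auto
  show "stage_val x v u d' \<le> stage_val x v u d"
    and "stage_val x v u d' = stage_val x v u d \<Longrightarrow> d' = d"
    using * stage_val_deviate_d[OF assms] assms(4) d' by auto
qed

lemma deviate_u_ge:
  assumes "x \<in> carrier_vec n" "u \<in> carrier_vec p" "u' \<in> carrier_vec p"
    and "v \<in> carrier_vec m" "d \<in> carrier_vec m"
    and "stationary_d x v u d" "stationary_u x u d"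
  shows "stage_val x v u d \<le> stage_val x v u' d"
proof -
  have "0 \<le> quad Huu (u' - u)"
    using Huu_pos_def assms quad_zero[OF coefficients_carrier(1)] unfolding pos_def_def
    by (metis minus_carrier_vec order_less_imp_le order_refl)
  then show ?thesis
    using stage_val_deviate_u[OF assms] by simp
qed

text \<open>The maximum over \<open>d\<close> is compared only along one line. Moving \<open>u\<close> in the direction of its half
  gradient \<open>r\<close> moves the best response of the adversary along a vector \<open>e\<close> with \<open>Hdd e = - Hdu r\<close>.
  On this line the maximum is a parabola with linear coefficient \<open>2 (r \<bullet> r)\<close>, which has its minimum
  at \<open>0\<close> only if \<open>r = 0\<close>.\<close>

lemma minimax_imp_stationary_u:
  assumes x: "x \<in> carrier_vec n" and u: "u \<in> carrier_vec p"
    and v: "v \<in> carrier_vec m" and d: "d \<in> carrier_vec m" "stationary_d x v u d"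
    and min: "\<And>u' d'. u' \<in> carrier_vec p \<Longrightarrow> d' \<in> carrier_vec m \<Longrightarrow> stationary_d x v u' d' \<Longrightarrow>
      stage_val x v u d \<le> stage_val x v u' d'"
  shows "stationary_u x u d"
proof -
  let ?r = "Huu *\<^sub>v u + Hud *\<^sub>v d - Gu *\<^sub>v x"
  have r: "?r \<in> carrier_vec p" using residual_carrier[OF x u d(1) v] by auto
  have Hr: "- (Hdu *\<^sub>v ?r) \<in> carrier_vec m"
    using r by (intro uminus_carrier_vec[THEN iffD2] mult_mat_vec_carrier[OF coefficients_carrier(4)])
  then obtain e where e: "e \<in> carrier_vec m" "Hdd *\<^sub>v e = - (Hdu *\<^sub>v ?r)"
    using pos_def_imp_solvable[OF Hdd_pos_def] by blast
  define c where "c = quad Huu ?r + 2 * (?r \<bullet> (Hud *\<^sub>v e)) - quad Hdd e"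
  have val: "0 \<le> 2 * s * (?r \<bullet> ?r) + s\<^sup>2 * c" for s :: real
  proof -
    let ?a = "s \<cdot>\<^sub>v ?r" and ?b = "s \<cdot>\<^sub>v e"
    have ab: "?a \<in> carrier_vec p" "?b \<in> carrier_vec m" using r e by auto
    have H: "Hdu *\<^sub>v u \<in> carrier_vec m" "Hdd *\<^sub>v d \<in> carrier_vec m" "M *\<^sub>v v \<in> carrier_vec m"
       "Hdu *\<^sub>v ?r \<in> carrier_vec m"
      using u d v M r mult_mat_vec_carrier[OF coefficients_carrier(4)]
        mult_mat_vec_carrier[OF coefficients_carrier(3)] by auto
    have "Hdu *\<^sub>v (u + ?a) + Hdd *\<^sub>v (d + ?b) - M *\<^sub>v v
        = (Hdu *\<^sub>v u + s \<cdot>\<^sub>v (Hdu *\<^sub>v ?r)) + (Hdd *\<^sub>v d + s \<cdot>\<^sub>v (- (Hdu *\<^sub>v ?r))) - M *\<^sub>v v"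
      unfolding mult_add_distrib_mat_vec[OF coefficients_carrier(4) u ab(1)]
        mult_add_distrib_mat_vec[OF coefficients_carrier(3) d(1) ab(2)]
        mult_mat_vec[OF coefficients_carrier(4) r] mult_mat_vec[OF coefficients_carrier(3) e(1)] e(2) ..
    also have "\<dots> = Hdu *\<^sub>v u + Hdd *\<^sub>v d - M *\<^sub>v v"
    proof -
      have "(a + s \<cdot>\<^sub>v w) + (b + s \<cdot>\<^sub>v (- w)) - z = a + b - z"
        if "a \<in> carrier_vec m" "b \<in> carrier_vec m" "z \<in> carrier_vec m" "w \<in> carrier_vec m"
        for a b z w :: "real vec"
        using that by (intro eq_vecI) auto
      then show ?thesis using H by blast
    qed
    finally have "stationary_d x v (u + ?a) (d + ?b)"
      using d(2) unfolding stationary_d_def by simp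
    then have "stage_val x v u d \<le> stage_val x v (u + ?a) (d + ?b)"
      using u d ab by (intro min) auto
    moreover have "Hud *\<^sub>v ?b = s \<cdot>\<^sub>v (Hud *\<^sub>v e)"
      by (rule mult_mat_vec[OF coefficients_carrier(2) e(1)])
    moreover have "Hud *\<^sub>v e \<in> carrier_vec p"
      by (rule mult_mat_vec_carrier[OF coefficients_carrier(2) e(1)])
    ultimately show ?thesis
      using stage_val_at_stationary_d[OF x u ab(1) v d(1) ab(2) d(2)] r
        quad_smult[OF coefficients_carrier(1) r] quad_smult[OF coefficients_carrier(3) e(1)]
      by (simp add: c_def algebra_simps power2_eq_square)
  qed
  have "?r \<bullet> ?r = 0"
    by (rule nonneg_quadratic_imp_linear_zero[of "?r \<bullet> ?r" c]) (rule val)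
  then have "?r = 0\<^sub>v p"
    using conjugate_square_eq_0_vec[OF r] by simp
  moreover have "a = b" if "a \<in> carrier_vec p" "b \<in> carrier_vec p" "a - b = 0\<^sub>v p" for a b :: "real vec"
  proof -
    have "a = (a - b) + b" using that(1,2) by (intro eq_vecI) auto
    then show ?thesis using that by simp
  qed
  ultimately show ?thesis
    using residual_carrier(1,2)[OF x u d(1) v] unfolding stationary_u_def by blast
qed

end

section \<open>The coupled stationarity conditions\<close>

lemma adv_dim_eq_sum_list: "adv_dim G i = (\<Sum>j\<leftarrow>others G i. input_dim G j)"
proof -
  have "{l \<in> {..<players G}. l \<noteq> i} = {..<players G} - {i}" by auto
  then show ?thesis
    by (simp only: adv_dim_def others_def sum_list_filter_upt)
qed

lemma set_others [simp]: "set (others G i) = {..<players G} - {i}"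
  by (auto simp: others_def)

text \<open>Separates the diagonal block from the others in a block row of \<open>H\<close>.\<close>

lemma sum_upt_eq_others:
  fixes f :: "nat \<Rightarrow> real"
  assumes "i < players G"
  shows "(\<Sum>j\<leftarrow>[0..<players G]. f j) = f i + (\<Sum>j\<leftarrow>others G i. f j)"
proof -
  have "distinct (others G i)" by (simp add: others_def)
  then have "(\<Sum>j\<leftarrow>others G i. f j) = (\<Sum>j\<in>{..<players G} - {i}. f j)"
    by (simp add: sum_list_distinct_conv_sum_set)
  moreover have "(\<Sum>j\<leftarrow>[0..<players G]. f j) = (\<Sum>j<players G. f j)"
    by (simp add: sum_list_distinct_conv_sum_set atLeast0LessThan)
  ultimately show ?thesis
    using assms by (simp add: sum.remove)
qed

lemma vstack_vec_pairs:
  "vstack_vec (concat (map (\<lambda>i. [a i, b i]) is)) = vstack_vec (map (\<lambda>i. a i @\<^sub>v b i) is)"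
proof -
  have "concat (map list_of_vec (concat (map (\<lambda>i. [a i, b i]) is)))
      = concat (map list_of_vec (map (\<lambda>i. a i @\<^sub>v b i) is))"
    by (induction "is") auto
  then show ?thesis by (simp add: vstack_vec_def)
qed

lemma M_sub_carrier: "M_sub G t i j \<in> carrier_mat (adv_dim G i) (input_dim G j)"
  by (simp add: M_sub_def)

text \<open>The blocks \<open>M_sub G t i j\<close> are the column blocks of \<open>M_mat G t i\<close>, so that the entries of a block row
  \<open>d\<^sup>i\<close> of \<open>H\<close> outside the diagonal add up to \<open>- M\<close> applied to the stacked inputs of the others.\<close>

lemma M_mat_mult_stack:
  assumes M: "M_mat G t i \<in> carrier_mat (adv_dim G i) (adv_dim G i)" and r: "r < adv_dim G i"
    and u: "\<And>j. j \<in> set (others G i) \<Longrightarrow> u j \<in> carrier_vec (input_dim G j)"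
  shows "(M_mat G t i *\<^sub>v vstack_vec (map u (others G i))) $ r
    = (\<Sum>j\<leftarrow>others G i. (M_sub G t i j *\<^sub>v u j) $ r)"
proof -
  let ?M = "M_mat G t i"
  have "row ?M r \<in> carrier_vec (\<Sum>j\<leftarrow>filter (\<lambda>j. j \<noteq> i) [0..<players G]. input_dim G j)"
    using M unfolding adv_dim_eq_sum_list others_def by (rule row_carrier_vec[OF r[unfolded adv_dim_eq_sum_list others_def]])
  then have "row ?M r = vstack_vec (map (\<lambda>j. vec (input_dim G j)
      (\<lambda>c. row ?M r $ ((\<Sum>l\<in>{l\<in>{..<j}. l \<noteq> i}. input_dim G l) + c))) (others G i))"
    unfolding others_def by (rule vec_eq_vstack_vec_blocks)
  also have "\<dots> = vstack_vec (map (\<lambda>j. row (M_sub G t i j) r) (others G i))"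
  proof (intro arg_cong[of _ _ vstack_vec] map_cong refl eq_vecI)
    fix j c assume j: "j \<in> set (others G i)" and "c < dim_vec (row (M_sub G t i j) r)"
    then have c: "c < input_dim G j" by (simp add: M_sub_def)
    have off: "{l\<in>{..<j}. l \<noteq> i} = {..<j} - {i}" by auto
    have "(\<Sum>l\<in>{..<j} - {i}. input_dim G l) + input_dim G j
        = (\<Sum>l\<in>insert j ({..<j} - {i}). input_dim G l)" by simp
    also have "\<dots> \<le> adv_dim G i"
      unfolding adv_dim_def using j by (intro sum_mono2) auto
    finally have "(\<Sum>l\<in>{..<j} - {i}. input_dim G l) + c < adv_dim G i" using c by simp
    then show "vec (input_dim G j) (\<lambda>c. row ?M r $ ((\<Sum>l\<in>{l\<in>{..<j}. l \<noteq> i}. input_dim G l) + c)) $ c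
        = row (M_sub G t i j) r $ c"
      unfolding off using r c M by (simp add: M_sub_def)
  qed (simp add: M_sub_def)
  finally have row: "row ?M r = vstack_vec (map (\<lambda>j. row (M_sub G t i j) r) (others G i))" .
  have "(?M *\<^sub>v vstack_vec (map u (others G i))) $ r = row ?M r \<bullet> vstack_vec (map u (others G i))"
    using M r by simp
  also have "\<dots> = (\<Sum>j\<leftarrow>others G i. row (M_sub G t i j) r \<bullet> u j)"
  proof -
    have "dim_vec (row (M_sub G t i j) r) = dim_vec (u j)" if "j \<in> set (others G i)" for j
      using carrier_vecD[OF u[OF that]] by (simp add: M_sub_def)
    then show ?thesis unfolding row by (rule scalar_prod_vstack_vec)
  qed
  also have "\<dots> = (\<Sum>j\<leftarrow>others G i. (M_sub G t i j *\<^sub>v u j) $ r)"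
    using r by (simp add: M_sub_def)
  finally show ?thesis .
qed

lemma zero_mat_mult_vec: "v \<in> carrier_vec l \<Longrightarrow> 0\<^sub>m k l *\<^sub>v v = (0\<^sub>v k :: real vec)"
  by (intro eq_vecI) auto

text \<open>The hypotheses of the theorem, apart from the initial state.\<close>

locale riccati_game =
  fixes G :: lq_game
  assumes well_formed: "well_formed G"
    and H_uu_pos_def: "\<And>t i. t < horizon G \<Longrightarrow> i < players G \<Longrightarrow>
           pos_def (input_dim G i) (H_uu G t (P_mat G (Suc t)) i)"
    and H_dd_pos_def: "\<And>t i. t < horizon G \<Longrightarrow> i < players G \<Longrightarrow>
           pos_def (adv_dim G i) (H_dd G t (P_mat G (Suc t)) i)"
    and H_invertible: "\<And>t. t < horizon G \<Longrightarrow> invertible_mat (H_mat G t (P_mat G (Suc t)))"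
begin

lemma B_others_carrier:
  assumes "t < horizon G"
  shows "B_others G t i \<in> carrier_mat (state_dim G) (adv_dim G i)"
proof -
  have "dim_col (B_mat G t j) = input_dim G j" if "j \<in> set (others G i)" for j
    using well_formed assms that by (auto simp: well_formed_def)
  then have "(\<Sum>j\<leftarrow>others G i. dim_col (B_mat G t j)) = adv_dim G i"
    unfolding adv_dim_eq_sum_list by (intro arg_cong[of _ _ sum_list] map_cong) auto
  then show ?thesis
    by (intro carrier_matI) (simp_all add: B_others_def comp_def)
qed

lemma K_L_carrier [simp]:
  "K_of G t P i \<in> carrier_mat (input_dim G i) (state_dim G)"
  "L_of G t P i \<in> carrier_mat (adv_dim G i) (state_dim G)"
  by (auto simp: K_of_def L_of_def)

lemma K_others_carrier [simp]: "K_others_of G t P i \<in> carrier_mat (adv_dim G i) (state_dim G)"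
  by (intro carrier_matI) (simp_all add: K_others_of_def comp_def adv_dim_eq_sum_list K_of_def)

lemma K_others_mult:
  "K_others_of G t P i *\<^sub>v x = vstack_vec (map (\<lambda>j. K_of G t P j *\<^sub>v x) (others G i))"
  unfolding K_others_of_def by (subst vstack_mult_vec) (auto simp: K_of_def comp_def)

lemma P_mat_horizon: "P_mat G (horizon G) = Q_mat G (horizon G)"
  by (simp add: P_mat_def)

lemma P_mat_step: "t < horizon G \<Longrightarrow> P_mat G t = riccati_step G t (P_mat G (Suc t))"
proof -
  assume t: "t < horizon G"
  then have "horizon G - t = Suc (horizon G - Suc t)" "horizon G - Suc (horizon G - Suc t) = t" by auto
  then show ?thesis by (simp add: P_mat_def)
qed

lemma data_carrier:
  assumes "t < horizon G" "i < players G"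
  shows "A_mat G t \<in> carrier_mat (state_dim G) (state_dim G)"
    and "B_mat G t i \<in> carrier_mat (state_dim G) (input_dim G i)"
    and "R_mat G t i \<in> carrier_mat (input_dim G i) (input_dim G i)" "transpose_mat (R_mat G t i) = R_mat G t i"
    and "S_mat G t i \<in> carrier_mat (adv_dim G i) (adv_dim G i)" "transpose_mat (S_mat G t i) = S_mat G t i"
    and "M_mat G t i \<in> carrier_mat (adv_dim G i) (adv_dim G i)" "transpose_mat (M_mat G t i) = M_mat G t i"
  using assms well_formed by (auto simp: well_formed_def pos_def_def pos_semidef_def)

lemma Q_carrier:
  assumes "t \<le> horizon G" "i < players G"
  shows "Q_mat G t i \<in> carrier_mat (state_dim G) (state_dim G)" "transpose_mat (Q_mat G t i) = Q_mat G t i"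
  using assms well_formed by (auto simp: well_formed_def pos_semidef_def)

lemma P_mat_symmetric:
  assumes "t \<le> horizon G" "i < players G"
  shows "P_mat G t i \<in> carrier_mat (state_dim G) (state_dim G) \<and> transpose_mat (P_mat G t i) = P_mat G t i"
  using assms(1)
proof (induction rule: inc_induct)
  case base
  then show ?case using Q_carrier[OF order_refl assms(2)] by (simp add: P_mat_horizon)
next
  case (step t)
  let ?n = "state_dim G"
  let ?P = "P_mat G (Suc t)"
  let ?K = "K_of G t ?P i" and ?L = "L_of G t ?P i"
  let ?D = "?L - K_others_of G t ?P i"
  let ?F = "A_mat G t + B_mat G t i * ?K + B_others G t i * ?L"
  note data = data_carrier[OF step.hyps(2) assms(2)] and B_others = B_others_carrier[OF step.hyps(2), of i]
  have Q: "Q_mat G t i \<in> carrier_mat ?n ?n" "transpose_mat (Q_mat G t i) = Q_mat G t i"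
    using Q_carrier step.hyps(2) assms(2) by auto
  have D: "?D \<in> carrier_mat (adv_dim G i) ?n" by (intro minus_carrier_mat K_others_carrier)
  have F: "?F \<in> carrier_mat ?n ?n"
    using data B_others by (intro add_carrier_mat mult_carrier_mat[OF B_others] K_L_carrier)
  have sym: "X + Y \<in> carrier_mat ?n ?n \<and> transpose_mat (X + Y) = X + Y"
      "X - Y \<in> carrier_mat ?n ?n \<and> transpose_mat (X - Y) = X - Y"
    if "X \<in> carrier_mat ?n ?n \<and> transpose_mat X = X" "Y \<in> carrier_mat ?n ?n \<and> transpose_mat Y = Y"
    for X Y :: "real mat"
    using that by (auto simp: transpose_add[of _ ?n ?n] transpose_minus[of _ ?n ?n])
  have cong: "transpose_mat F * X * F \<in> carrier_mat ?n ?n \<and>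
      transpose_mat (transpose_mat F * X * F) = transpose_mat F * X * F"
    if "F \<in> carrier_mat m ?n" "X \<in> carrier_mat m m" "transpose_mat X = X" for F X :: "real mat" and m
    using symmetric_congruence[OF that] that by (auto intro!: mult_carrier_mat)
  have "P_mat G t i = Q_mat G t i + transpose_mat ?K * R_mat G t i * ?K - transpose_mat ?L * S_mat G t i * ?L
      - transpose_mat ?D * M_mat G t i * ?D + transpose_mat ?F * ?P i * ?F"
    unfolding P_mat_step[OF step.hyps(2)] riccati_step_def Let_def ..
  moreover have "\<dots> \<in> carrier_mat ?n ?n \<and> transpose_mat \<dots> = \<dots>"
    using Q data step.IH
    by (intro sym cong[OF K_L_carrier(1)] cong[OF K_L_carrier(2)] cong[OF D] cong[OF F] conjI) auto
  ultimately show ?case by simp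
qed

lemma stage_game:
  assumes t: "t < horizon G" and i: "i < players G"
  shows "saddle_stage_game (state_dim G) (input_dim G i) (adv_dim G i) (A_mat G t) (B_mat G t i)
    (B_others G t i) (Q_mat G t i) (R_mat G t i) (S_mat G t i) (M_mat G t i) (P_mat G (Suc t) i)"
proof -
  interpret one_stage_game "state_dim G" "input_dim G i" "adv_dim G i" "A_mat G t" "B_mat G t i"
    "B_others G t i" "Q_mat G t i" "R_mat G t i" "S_mat G t i" "M_mat G t i" "P_mat G (Suc t) i"
    using t P_mat_symmetric[of "Suc t" i] i
    by (intro one_stage_game.intro data_carrier B_others_carrier Q_carrier) auto
  show ?thesis
    using H_uu_pos_def[OF t i] H_dd_pos_def[OF t i]
    by unfold_locales (simp_all add: Huu_def Hdd_def H_uu_def H_dd_def)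
qed

text \<open>The payoff and the stationarity conditions of player \<open>i\<close> at time \<open>t\<close> when the cost to go is given
  by the Riccati matrix.\<close>

abbreviation game_val where
  "game_val t i \<equiv> one_stage_game.stage_val (A_mat G t) (B_mat G t i)
    (B_others G t i) (Q_mat G t i) (R_mat G t i) (S_mat G t i) (M_mat G t i) (P_mat G (Suc t) i)"

abbreviation game_stationary_u where
  "game_stationary_u t i \<equiv> one_stage_game.stationary_u (A_mat G t) (B_mat G t i)
    (B_others G t i) (R_mat G t i) (P_mat G (Suc t) i)"

abbreviation game_stationary_d where
  "game_stationary_d t i \<equiv> one_stage_game.stationary_d (A_mat G t) (B_mat G t i)
    (B_others G t i) (S_mat G t i) (M_mat G t i) (P_mat G (Suc t) i)"

lemma H_row_mult:
  assumes t: "t < horizon G" and i: "i < players G" and P_eq: "P = P_mat G (Suc t)"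
    and u: "\<And>j. j < players G \<Longrightarrow> u j \<in> carrier_vec (input_dim G j)"
    and d: "\<And>j. j < players G \<Longrightarrow> d j \<in> carrier_vec (adv_dim G j)"
  shows "hstack (pair_dim G i) (map (H_block G t P i) [0..<players G]) *\<^sub>v
      vstack_vec (map (\<lambda>j. u j @\<^sub>v d j) [0..<players G])
    = (H_uu G t P i *\<^sub>v u i + H_ud G t P i *\<^sub>v d i) @\<^sub>v
      (H_du G t P i *\<^sub>v u i + H_dd G t P i *\<^sub>v d i - M_mat G t i *\<^sub>v vstack_vec (map u (others G i)))"
    (is "?H *\<^sub>v ?z = ?top @\<^sub>v (?bot - ?Mv)")
proof -
  interpret saddle_stage_game "state_dim G" "input_dim G i" "adv_dim G i" "A_mat G t" "B_mat G t i"
    "B_others G t i" "Q_mat G t i" "R_mat G t i" "S_mat G t i" "M_mat G t i" "P_mat G (Suc t) i"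
    by (rule stage_game[OF t i])
  have H: "H_uu G t P i \<in> carrier_mat (input_dim G i) (input_dim G i)"
      "H_ud G t P i \<in> carrier_mat (input_dim G i) (adv_dim G i)"
      "H_du G t P i \<in> carrier_mat (adv_dim G i) (input_dim G i)"
      "H_dd G t P i \<in> carrier_mat (adv_dim G i) (adv_dim G i)"
    using coefficients_carrier
    by (auto simp: P_eq H_uu_def H_ud_def H_du_def H_dd_def Huu_def Hud_def Hdu_def Hdd_def)
  have block: "H_block G t P i j \<in> carrier_mat (pair_dim G i) (pair_dim G j)" for j
    using H by (auto simp: H_block_def pair_dim_def M_sub_carrier intro!: four_block_carrier_mat)
  have top: "?top \<in> carrier_vec (input_dim G i)" and bot: "?bot \<in> carrier_vec (adv_dim G i)"
    using H u[OF i] d[OF i] by (auto intro!: add_carrier_vec mult_mat_vec_carrier)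
  have Mv: "?Mv \<in> carrier_vec (adv_dim G i)"
    using M(1) by (intro carrier_vecI) simp
  have diag: "H_block G t P i i *\<^sub>v (u i @\<^sub>v d i) = ?top @\<^sub>v ?bot"
    using H u[OF i] d[OF i] by (simp add: H_block_def four_block_mat_mult_vec)
  have off_diag: "H_block G t P i j *\<^sub>v (u j @\<^sub>v d j)
      = 0\<^sub>v (input_dim G i) @\<^sub>v - (M_sub G t i j *\<^sub>v u j)" if j: "j \<in> set (others G i)" for j
  proof -
    have j': "j < players G" "j \<noteq> i" using j by auto
    have "H_block G t P i j *\<^sub>v (u j @\<^sub>v d j)
      = (0\<^sub>m (input_dim G i) (input_dim G j) *\<^sub>v u j + 0\<^sub>m (input_dim G i) (adv_dim G j) *\<^sub>v d j) @\<^sub>v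
        (- M_sub G t i j *\<^sub>v u j + 0\<^sub>m (adv_dim G i) (adv_dim G j) *\<^sub>v d j)"
      unfolding H_block_def if_not_P[OF j'(2)]
      by (rule four_block_mat_mult_vec[OF zero_carrier_mat zero_carrier_mat
          uminus_carrier_iff_mat[THEN iffD2, OF M_sub_carrier] zero_carrier_mat u[OF j'(1)] d[OF j'(1)]])
    also have "- M_sub G t i j *\<^sub>v u j = - (M_sub G t i j *\<^sub>v u j)"
      using carrier_vecD[OF u[OF j'(1)]] by (intro uminus_mult_mat_vec) (simp add: M_sub_def)
    finally show ?thesis
      using mult_mat_vec_carrier[OF M_sub_carrier[of G t i j] u[OF j'(1)]]
      by (simp add: zero_mat_mult_vec[OF u[OF j'(1)]] zero_mat_mult_vec[OF d[OF j'(1)]])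
  qed
  show ?thesis
  proof (rule eq_vecI)
    fix r assume "r < dim_vec (?top @\<^sub>v (?bot - ?Mv))"
    then have r: "r < pair_dim G i" by (simp only: index_append_vec(2) index_minus_vec(2)
          carrier_vecD[OF top] carrier_vecD[OF Mv] pair_dim_def)
    let ?p = "input_dim G i"
    have "(?H *\<^sub>v ?z) $ r = (\<Sum>j\<leftarrow>[0..<players G]. (H_block G t P i j *\<^sub>v (u j @\<^sub>v d j)) $ r)"
    proof (rule hstack_mult_vstack_vec[OF _ r])
      fix j assume "j \<in> set [0..<players G]"
      then have "dim_vec (u j @\<^sub>v d j) = pair_dim G j"
        using carrier_vecD[OF u[of j]] carrier_vecD[OF d[of j]] by (simp add: pair_dim_def)
      then show "H_block G t P i j \<in> carrier_mat (pair_dim G i) (dim_vec (u j @\<^sub>v d j))"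
        using block[of j] by simp
    qed
    also have "\<dots> = (?top @\<^sub>v ?bot) $ r + (\<Sum>j\<leftarrow>others G i. (H_block G t P i j *\<^sub>v (u j @\<^sub>v d j)) $ r)"
      by (simp only: sum_upt_eq_others[OF i] diag)
    also have "(\<Sum>j\<leftarrow>others G i. (H_block G t P i j *\<^sub>v (u j @\<^sub>v d j)) $ r)
        = (\<Sum>j\<leftarrow>others G i. (0\<^sub>v ?p @\<^sub>v - (M_sub G t i j *\<^sub>v u j)) $ r)"
      by (intro arg_cong[of _ _ sum_list] map_cong refl) (simp only: off_diag)
    also have "(\<Sum>j\<leftarrow>others G i. (0\<^sub>v ?p @\<^sub>v - (M_sub G t i j *\<^sub>v u j)) $ r)
        = (if r < ?p then 0 else - (\<Sum>j\<leftarrow>others G i. (M_sub G t i j *\<^sub>v u j) $ (r - ?p)))"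
    proof -
      have "(0\<^sub>v ?p @\<^sub>v - (M_sub G t i j *\<^sub>v u j)) $ r
          = (if r < ?p then 0 else - ((M_sub G t i j *\<^sub>v u j) $ (r - ?p)))" for j
        using r by (auto simp: pair_dim_def M_sub_def)
      then show ?thesis by (simp add: uminus_sum_list_map comp_def)
    qed
    also have "\<dots> = (if r < ?p then 0 else - (?Mv $ (r - ?p)))"
    proof (cases "r < ?p")
      case False
      then have "r - ?p < adv_dim G i" using r by (simp add: pair_dim_def)
      then show ?thesis
        using M_mat_mult_stack[OF M(1), of "r - ?p" u] u False by simp
    qed simp
    also have "(?top @\<^sub>v ?bot) $ r + (if r < ?p then 0 else - (?Mv $ (r - ?p))) = (?top @\<^sub>v (?bot - ?Mv)) $ r"
    proof -
      have "(a @\<^sub>v b) $ r + (if r < ?p then 0 else - (c $ (r - ?p))) = (a @\<^sub>v (b - c)) $ r"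
        if "a \<in> carrier_vec ?p" "b \<in> carrier_vec (adv_dim G i)" "c \<in> carrier_vec (adv_dim G i)"
        for a b c :: "real vec"
        using that r by (auto simp: pair_dim_def)
      then show ?thesis using top bot Mv by blast
    qed
    finally show "(?H *\<^sub>v ?z) $ r = (?top @\<^sub>v (?bot - ?Mv)) $ r" .
  qed (simp only: index_append_vec(2) index_minus_vec(2) carrier_vecD[OF top] carrier_vecD[OF Mv]
      carrier_matD(1)[OF M(1)] pair_dim_def dim_mult_mat_vec dim_hstack)
qed

text \<open>The linear system with matrix \<open>H\<close> is the conjunction of the stationarity conditions of all players
  at the state \<open>x\<close>; the actual inputs \<open>v\<close> seen by the adversary of \<open>i\<close> are the unknowns \<open>u\<^sup>j\<close> of the
  other players.\<close>

lemma H_system_iff_stationary: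
  assumes t: "t < horizon G" and P_eq: "P = P_mat G (Suc t)" and x: "x \<in> carrier_vec (state_dim G)"
    and u: "\<And>j. j < players G \<Longrightarrow> u j \<in> carrier_vec (input_dim G j)"
    and d: "\<And>j. j < players G \<Longrightarrow> d j \<in> carrier_vec (adv_dim G j)"
  shows "H_mat G t P *\<^sub>v vstack_vec (map (\<lambda>j. u j @\<^sub>v d j) [0..<players G]) = G_stack G t P *\<^sub>v x \<longleftrightarrow>
    (\<forall>i<players G. game_stationary_u t i x (u i) (d i) \<and>
       game_stationary_d t i x (vstack_vec (map u (others G i))) (u i) (d i))"
proof -
  let ?z = "vstack_vec (map (\<lambda>j. u j @\<^sub>v d j) [0..<players G])"
  let ?top = "\<lambda>i. H_uu G t P i *\<^sub>v u i + H_ud G t P i *\<^sub>v d i"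
  let ?bot = "\<lambda>i. H_du G t P i *\<^sub>v u i + H_dd G t P i *\<^sub>v d i - M_mat G t i *\<^sub>v vstack_vec (map u (others G i))"
  have G: "G_u G t P i \<in> carrier_mat (input_dim G i) (state_dim G)"
      "G_d G t P i \<in> carrier_mat (adv_dim G i) (state_dim G)"
    and top: "?top i \<in> carrier_vec (input_dim G i)" and bot: "?bot i \<in> carrier_vec (adv_dim G i)"
    and stationary: "game_stationary_u t i x (u i) (d i) \<longleftrightarrow> ?top i = G_u G t P i *\<^sub>v x"
      "game_stationary_d t i x (vstack_vec (map u (others G i))) (u i) (d i) \<longleftrightarrow> ?bot i = G_d G t P i *\<^sub>v x"
    if i: "i < players G" for i
  proof -
    interpret saddle_stage_game "state_dim G" "input_dim G i" "adv_dim G i" "A_mat G t" "B_mat G t i"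
      "B_others G t i" "Q_mat G t i" "R_mat G t i" "S_mat G t i" "M_mat G t i" "P_mat G (Suc t) i"
      by (rule stage_game[OF t i])
    have H: "H_uu G t P i = Huu" "H_ud G t P i = Hud" "H_du G t P i = Hdu" "H_dd G t P i = Hdd"
      "G_u G t P i = Gu" "G_d G t P i = Gd"
      by (simp_all add: P_eq H_uu_def H_ud_def H_du_def H_dd_def Huu_def Hud_def Hdu_def Hdd_def
          G_u_def G_d_def Gu_def Gd_def)
    show "G_u G t P i \<in> carrier_mat (input_dim G i) (state_dim G)"
      "G_d G t P i \<in> carrier_mat (adv_dim G i) (state_dim G)"
      unfolding H by (rule coefficients_carrier)+
    have v: "vstack_vec (map u (others G i)) \<in> carrier_vec (adv_dim G i)"
    proof (rule carrier_vecI)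
      have "(\<Sum>j\<leftarrow>others G i. dim_vec (u j)) = (\<Sum>j\<leftarrow>others G i. input_dim G j)"
        using carrier_vecD[OF u] by (intro arg_cong[of _ _ sum_list] map_cong) auto
      then show "dim_vec (vstack_vec (map u (others G i))) = adv_dim G i"
        by (simp add: adv_dim_eq_sum_list comp_def)
    qed
    show "?top i \<in> carrier_vec (input_dim G i)" "?bot i \<in> carrier_vec (adv_dim G i)"
      unfolding H using residual_carrier[OF x u[OF i] d[OF i] v] by auto
    show "game_stationary_u t i x (u i) (d i) \<longleftrightarrow> ?top i = G_u G t P i *\<^sub>v x"
      "game_stationary_d t i x (vstack_vec (map u (others G i))) (u i) (d i) \<longleftrightarrow> ?bot i = G_d G t P i *\<^sub>v x"
      unfolding H stationary_u_def stationary_d_def by (rule refl)+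
  qed
  have "H_mat G t P *\<^sub>v ?z = vstack_vec (map (\<lambda>i.
      hstack (pair_dim G i) (map (H_block G t P i) [0..<players G]) *\<^sub>v ?z) [0..<players G])"
  proof -
    have dim: "dim_col (H_block G t P i j) = pair_dim G j" if "i < players G" for i j
    proof (cases "i = j")
      case True
      interpret saddle_stage_game "state_dim G" "input_dim G i" "adv_dim G i" "A_mat G t" "B_mat G t i"
        "B_others G t i" "Q_mat G t i" "R_mat G t i" "S_mat G t i" "M_mat G t i" "P_mat G (Suc t) i"
        by (rule stage_game[OF t that])
      have "H_uu G t P i = Huu" "H_dd G t P i = Hdd"
        by (simp_all add: P_eq H_uu_def H_dd_def Huu_def Hdd_def)
      then show ?thesis
        using True coefficients_carrier(1,3) by (auto simp: H_block_def pair_dim_def)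
    qed (simp add: H_block_def pair_dim_def)
    have "dim_col (hstack (pair_dim G i) (map (H_block G t P i) [0..<players G]))
        = (\<Sum>j<players G. pair_dim G j)" if "i < players G" for i
      using dim[OF that]
      by (simp add: comp_def sum_list_distinct_conv_sum_set atLeast0LessThan)
    then show ?thesis
      unfolding H_mat_def by (subst vstack_mult_vec) (auto simp: comp_def)
  qed
  also have "\<dots> = vstack_vec (map (\<lambda>i. ?top i @\<^sub>v ?bot i) [0..<players G])"
    using H_row_mult[OF t _ P_eq u d] by (intro arg_cong[of _ _ vstack_vec] map_cong) auto
  finally have Hz: "H_mat G t P *\<^sub>v ?z = \<dots>" .
  have "G_stack G t P *\<^sub>v x
      = vstack_vec (map (\<lambda>B. B *\<^sub>v x) (concat (map (\<lambda>i. [G_u G t P i, G_d G t P i]) [0..<players G])))"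
    unfolding G_stack_def using carrier_matD(2)[OF G(1)] carrier_matD(2)[OF G(2)]
    by (subst vstack_mult_vec) auto
  also have "\<dots> = vstack_vec (map (\<lambda>i. (G_u G t P i *\<^sub>v x) @\<^sub>v (G_d G t P i *\<^sub>v x)) [0..<players G])"
    by (simp add: map_concat comp_def vstack_vec_pairs)
  finally have Gx: "G_stack G t P *\<^sub>v x = \<dots>" .
  have dims: "dim_vec (?top i @\<^sub>v ?bot i) = dim_vec ((G_u G t P i *\<^sub>v x) @\<^sub>v (G_d G t P i *\<^sub>v x))"
    if "i \<in> set [0..<players G]" for i
  proof -
    have i: "i < players G" using that by simp
    show ?thesis
      unfolding index_append_vec(2) dim_mult_mat_vec
      using carrier_vecD[OF top[OF i]] carrier_vecD[OF bot[OF i]]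
        carrier_matD(1)[OF G(1)[OF i]] carrier_matD(1)[OF G(2)[OF i]] by (simp only:)
  qed
  have "H_mat G t P *\<^sub>v ?z = G_stack G t P *\<^sub>v x
    \<longleftrightarrow> (\<forall>i<players G. ?top i @\<^sub>v ?bot i = (G_u G t P i *\<^sub>v x) @\<^sub>v (G_d G t P i *\<^sub>v x))"
    unfolding Hz Gx
    by (subst vstack_vec_map_eq_iff, erule dims) (simp only: set_upt atLeast0LessThan Ball_def lessThan_iff)
  also have "\<dots> \<longleftrightarrow> (\<forall>i<players G. ?top i = G_u G t P i *\<^sub>v x \<and> ?bot i = G_d G t P i *\<^sub>v x)"
    using append_vec_eq[OF top mult_mat_vec_carrier[OF G(1) x]] by blast
  finally show ?thesis using stationary by auto
qed

lemma H_mat_inverse: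
  assumes t: "t < horizon G" and P_eq: "P = P_mat G (Suc t)"
  defines "D \<equiv> \<Sum>j<players G. pair_dim G j"
  obtains X where "mat_inverse (H_mat G t P) = Some X" "X \<in> carrier_mat D D"
    "H_mat G t P \<in> carrier_mat D D" "H_mat G t P * X = 1\<^sub>m D" "X * H_mat G t P = 1\<^sub>m D"
proof -
  let ?H = "H_mat G t P"
  have inv: "invertible_mat ?H" using H_invertible t P_eq by simp
  have "dim_col ?H = D" by (simp add: H_mat_def D_def)
  then have H: "?H \<in> carrier_mat D D"
    using inv by (intro carrier_matI) (auto simp: invertible_mat_def)
  obtain X where X: "?H * X = 1\<^sub>m D" "X * ?H = 1\<^sub>m (dim_row X)"
    using inv H by (auto simp: invertible_mat_def inverts_mat_def)
  have "dim_col (?H * X) = D" "dim_col (X * ?H) = dim_row X"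
    unfolding X by simp_all
  then have "X \<in> carrier_mat D D" using H by auto
  then have "?H \<in> Units (ring_mat TYPE(real) D ())"
    using H X by (auto simp: Units_def ring_mat_simps intro!: bexI[of _ X])
  then obtain Y where Y: "mat_inverse ?H = Some Y"
    using mat_inverse(1)[OF H, of "()"] by (cases "mat_inverse ?H") auto
  show thesis using that[OF Y] mat_inverse(2)[OF H Y] H by blast
qed

text \<open>Undoes the cutting of the stacked gains into \<open>K\<close> and \<open>L\<close>.\<close>

lemma gain_stack_mult:
  assumes t: "t < horizon G" and P_eq: "P = P_mat G (Suc t)" and x: "x \<in> carrier_vec (state_dim G)"
  shows "gain_stack G t P *\<^sub>v x
    = vstack_vec (map (\<lambda>j. (K_of G t P j *\<^sub>v x) @\<^sub>v (L_of G t P j *\<^sub>v x)) [0..<players G])"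
proof -
  let ?D = "\<Sum>j<players G. pair_dim G j" and ?Y = "gain_stack G t P"
  obtain X where X: "mat_inverse (H_mat G t P) = Some X" "X \<in> carrier_mat ?D ?D"
    using H_mat_inverse[OF t P_eq] by blast
  have Y: "dim_row ?Y = ?D" "dim_col ?Y = state_dim G"
    using X by (auto simp: gain_stack_def G_stack_def)
  let ?block = "\<lambda>j. vec (pair_dim G j) (\<lambda>r. (?Y *\<^sub>v x) $ ((\<Sum>l<j. pair_dim G l) + r))"
  have "?Y *\<^sub>v x \<in> carrier_vec (\<Sum>j\<leftarrow>filter (\<lambda>_. True) [0..<players G]. pair_dim G j)"
    by (intro carrier_vecI) (simp add: Y sum_list_distinct_conv_sum_set atLeast0LessThan)
  then have "?Y *\<^sub>v x = vstack_vec (map ?block [0..<players G])"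
    using vec_eq_vstack_vec_blocks[of "?Y *\<^sub>v x" "pair_dim G" "\<lambda>_. True" "players G"]
    by (simp add: lessThan_def)
  also have "\<dots> = vstack_vec (map (\<lambda>j. (K_of G t P j *\<^sub>v x) @\<^sub>v (L_of G t P j *\<^sub>v x)) [0..<players G])"
  proof (intro arg_cong[of _ _ vstack_vec] map_cong refl eq_vecI)
    fix j r assume j: "j \<in> set [0..<players G]"
      and "r < dim_vec ((K_of G t P j *\<^sub>v x) @\<^sub>v (L_of G t P j *\<^sub>v x))"
    then have r: "r < input_dim G j + adv_dim G j" by (simp add: K_of_def L_of_def)
    let ?o = "\<Sum>l<j. pair_dim G l"
    have "?o + pair_dim G j = (\<Sum>l\<in>insert j {..<j}. pair_dim G l)" by simp
    also have "\<dots> \<le> ?D" using j by (intro sum_mono2) auto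
    finally have o: "?o + r < ?D" using r by (simp add: pair_dim_def)
    have "?block j $ r = row ?Y (?o + r) \<bullet> x"
      using r o Y by (simp add: pair_dim_def)
    also have "\<dots> = ((K_of G t P j *\<^sub>v x) @\<^sub>v (L_of G t P j *\<^sub>v x)) $ r"
    proof (cases "r < input_dim G j")
      case True
      then have "row ?Y (?o + r) = row (K_of G t P j) r"
        using o Y by (intro eq_vecI) (auto simp: K_of_def)
      then show ?thesis using True by (simp add: K_of_def)
    next
      case False
      then have "row ?Y (?o + r) = row (L_of G t P j) (r - input_dim G j)"
        using o Y r by (intro eq_vecI) (auto simp: L_of_def)
      then show ?thesis using False r by (simp add: K_of_def L_of_def)
    qed
    finally show "?block j $ r = ((K_of G t P j *\<^sub>v x) @\<^sub>v (L_of G t P j *\<^sub>v x)) $ r" .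
  qed (simp add: pair_dim_def K_of_def L_of_def)
  finally show ?thesis .
qed

lemma G_stack_carrier:
  assumes t: "t < horizon G" and P_eq: "P = P_mat G (Suc t)"
  shows "G_stack G t P \<in> carrier_mat (\<Sum>j<players G. pair_dim G j) (state_dim G)"
proof -
  have "(\<Sum>B\<leftarrow>concat (map (\<lambda>i. [G_u G t P i, G_d G t P i]) is). dim_row B) = (\<Sum>j\<leftarrow>is. pair_dim G j)"
    if "set is \<subseteq> {..<players G}" for "is"
    using that data_carrier(2)[OF t] carrier_matD(2)[OF B_others_carrier[OF t]]
    by (induction "is") (auto simp: G_u_def G_d_def pair_dim_def)
  from this[of "[0..<players G]"] show ?thesis
    by (intro carrier_matI)
      (auto simp: G_stack_def comp_def sum_list_distinct_conv_sum_set atLeast0LessThan)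
qed

lemma gains_stationary:
  assumes t: "t < horizon G" and i: "i < players G" and x: "x \<in> carrier_vec (state_dim G)"
  shows "game_stationary_u t i x (K_mat G t i *\<^sub>v x) (L_mat G t i *\<^sub>v x)"
    and "game_stationary_d t i x (K_others_of G t (P_mat G (Suc t)) i *\<^sub>v x) (K_mat G t i *\<^sub>v x) (L_mat G t i *\<^sub>v x)"
proof -
  let ?D = "\<Sum>j<players G. pair_dim G j" and ?P = "P_mat G (Suc t)"
  let ?H = "H_mat G t ?P"
  obtain X where X: "mat_inverse ?H = Some X" "X \<in> carrier_mat ?D ?D" "?H \<in> carrier_mat ?D ?D" "?H * X = 1\<^sub>m ?D"
    using H_mat_inverse[OF t refl] by blast
  note GS = G_stack_carrier[OF t refl]
  have "?H *\<^sub>v (gain_stack G t ?P *\<^sub>v x) = (?H * (X * G_stack G t ?P)) *\<^sub>v x"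
    using X GS x assoc_mult_mat_vec[OF X(3) mult_carrier_mat[OF X(2) GS] x] by (simp add: gain_stack_def)
  also have "?H * (X * G_stack G t ?P) = G_stack G t ?P"
    using assoc_mult_mat[OF X(3,2) GS] X(4) GS by simp
  finally have "?H *\<^sub>v vstack_vec (map (\<lambda>j. (K_of G t ?P j *\<^sub>v x) @\<^sub>v (L_of G t ?P j *\<^sub>v x)) [0..<players G])
      = G_stack G t ?P *\<^sub>v x"
    unfolding gain_stack_mult[OF t refl x] .
  then have "\<forall>i<players G. game_stationary_u t i x (K_of G t ?P i *\<^sub>v x) (L_of G t ?P i *\<^sub>v x) \<and>
       game_stationary_d t i x (vstack_vec (map (\<lambda>j. K_of G t ?P j *\<^sub>v x) (others G i)))
         (K_of G t ?P i *\<^sub>v x) (L_of G t ?P i *\<^sub>v x)"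
    using x by (subst (asm) H_system_iff_stationary[OF t refl x])
      (auto intro!: mult_mat_vec_carrier[OF K_L_carrier(1)] mult_mat_vec_carrier[OF K_L_carrier(2)])
  then show "game_stationary_u t i x (K_mat G t i *\<^sub>v x) (L_mat G t i *\<^sub>v x)"
    and "game_stationary_d t i x (K_others_of G t ?P i *\<^sub>v x) (K_mat G t i *\<^sub>v x) (L_mat G t i *\<^sub>v x)"
    using i unfolding K_others_mult K_mat_def L_mat_def by auto
qed

text \<open>This is where invertibility of \<open>H\<close> gives uniqueness.\<close>

lemma stationary_imp_gain:
  assumes t: "t < horizon G" and i: "i < players G" and x: "x \<in> carrier_vec (state_dim G)"
    and u: "\<And>j. j < players G \<Longrightarrow> u j \<in> carrier_vec (input_dim G j)"
    and d: "\<And>j. j < players G \<Longrightarrow> d j \<in> carrier_vec (adv_dim G j)"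
    and su: "\<And>j. j < players G \<Longrightarrow> game_stationary_u t j x (u j) (d j)"
    and sd: "\<And>j. j < players G \<Longrightarrow> game_stationary_d t j x (vstack_vec (map u (others G j))) (u j) (d j)"
  shows "u i = K_mat G t i *\<^sub>v x"
proof -
  let ?D = "\<Sum>j<players G. pair_dim G j" and ?P = "P_mat G (Suc t)"
  let ?H = "H_mat G t ?P"
  let ?z = "vstack_vec (map (\<lambda>j. u j @\<^sub>v d j) [0..<players G])"
  obtain X where X: "mat_inverse ?H = Some X" "X \<in> carrier_mat ?D ?D" "?H \<in> carrier_mat ?D ?D" "X * ?H = 1\<^sub>m ?D"
    using H_mat_inverse[OF t refl] by blast
  note GS = G_stack_carrier[OF t refl]
  have dims: "dim_vec (u j) = input_dim G j" "dim_vec (d j) = adv_dim G j" if "j < players G" for j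
    using u d that by auto
  have z: "?z \<in> carrier_vec ?D"
  proof (rule carrier_vecI)
    have "dim_vec ?z = (\<Sum>j\<leftarrow>[0..<players G]. pair_dim G j)"
      unfolding dim_vstack_vec map_map
      by (intro arg_cong[of _ _ sum_list] map_cong refl) (simp add: dims pair_dim_def)
    then show "dim_vec ?z = ?D" by (simp add: sum_list_distinct_conv_sum_set atLeast0LessThan)
  qed
  have "?H *\<^sub>v ?z = G_stack G t ?P *\<^sub>v x"
    using su sd by (subst H_system_iff_stationary[OF t refl x u d]) auto
  then have "X *\<^sub>v (?H *\<^sub>v ?z) = X *\<^sub>v (G_stack G t ?P *\<^sub>v x)" by simp
  also have "X *\<^sub>v (?H *\<^sub>v ?z) = ?z"
    using assoc_mult_mat_vec[OF X(2,3) z] X(4) z by simp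
  also have "X *\<^sub>v (G_stack G t ?P *\<^sub>v x) = gain_stack G t ?P *\<^sub>v x"
    using assoc_mult_mat_vec[OF X(2) GS x] X(1) by (simp add: gain_stack_def)
  finally have eq: "?z = vstack_vec (map (\<lambda>j. (K_of G t ?P j *\<^sub>v x) @\<^sub>v (L_of G t ?P j *\<^sub>v x)) [0..<players G])"
    unfolding gain_stack_mult[OF t refl x] .
  have "\<forall>j\<in>set [0..<players G]. u j @\<^sub>v d j = (K_of G t ?P j *\<^sub>v x) @\<^sub>v (L_of G t ?P j *\<^sub>v x)"
    by (rule vstack_vec_map_eq_iff[THEN iffD1, OF _ eq]) (simp add: dims K_of_def L_of_def)
  then have "u i @\<^sub>v d i = (K_of G t ?P i *\<^sub>v x) @\<^sub>v (L_of G t ?P i *\<^sub>v x)" using i by simp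
  then show ?thesis
    using append_vec_eq[OF u[OF i] mult_mat_vec_carrier[OF K_L_carrier(1) x]]
    by (simp add: K_mat_def)
qed

lemma riccati_value:
  assumes t: "t < horizon G" and i: "i < players G" and x: "x \<in> carrier_vec (state_dim G)"
  shows "quad (P_mat G t i) x
    = game_val t i x (K_others_of G t (P_mat G (Suc t)) i *\<^sub>v x) (K_mat G t i *\<^sub>v x) (L_mat G t i *\<^sub>v x)"
proof -
  interpret saddle_stage_game "state_dim G" "input_dim G i" "adv_dim G i" "A_mat G t" "B_mat G t i"
    "B_others G t i" "Q_mat G t i" "R_mat G t i" "S_mat G t i" "M_mat G t i" "P_mat G (Suc t) i"
    by (rule stage_game[OF t i])
  show ?thesis
    unfolding P_mat_step[OF t] riccati_step_def Let_def K_mat_def L_mat_def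
    by (rule stage_val_feedback[OF x K_L_carrier(1) K_L_carrier(2) K_others_carrier])
qed

end

section \<open>Histories, policies and payoffs\<close>

lemma space_vec_borel [simp]: "space (vec_borel m) = carrier_vec m"
  by (simp add: vec_borel_def)

lemma policy_value_carrier:
  assumes "\<sigma> \<in> feedback_policies G m" "t < horizon G" "h \<in> histories G x0 t"
  shows "\<sigma> t h \<in> carrier_vec m"
proof -
  have meas: "\<sigma> t \<in> measurable (Pi\<^sub>M {..t} (\<lambda>_. vec_borel (state_dim G))) (vec_borel m)"
    using assms by (simp add: feedback_policies_def)
  have "h \<in> space (Pi\<^sub>M {..t} (\<lambda>_. vec_borel (state_dim G)))"
    using assms by (simp add: histories_def space_PiM)
  from measurable_space[OF meas this] show ?thesis by simp
qed

text \<open>\<open>vec_borel\<close> is pulled back along the coordinate map, so coordinates are measurable by construction.\<close>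

lemma measurable_vec_borel_index:
  assumes "l < n"
  shows "(\<lambda>v. v $ l) \<in> borel_measurable (vec_borel n)"
proof -
  have "(\<lambda>v. \<lambda>k\<in>{..<n}. v $ k) \<in> measurable (vec_borel n) (Pi\<^sub>M {..<n} (\<lambda>_. borel :: real measure))"
    unfolding vec_borel_def by (intro measurable_vimage_algebra1) (auto simp: space_PiM)
  from measurable_compose[OF this measurable_component_singleton[of l]]
  show ?thesis using assms by simp
qed

lemma linear_feedback_policy:
  assumes "\<And>t. t < horizon G \<Longrightarrow> E t \<in> carrier_mat m (state_dim G)"
  shows "(\<lambda>t h. E t *\<^sub>v h t) \<in> feedback_policies G m"
  unfolding feedback_policies_def
proof (intro CollectI allI impI)
  fix t assume "t < horizon G"
  then have E: "E t \<in> carrier_mat m (state_dim G)" by (rule assms)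
  let ?N = "Pi\<^sub>M {..t} (\<lambda>_. vec_borel (state_dim G))"
  have comp: "(\<lambda>h. h t $ l) \<in> borel_measurable ?N" if "l < state_dim G" for l
    using measurable_compose[OF measurable_component_singleton[of t "{..t}"] measurable_vec_borel_index[OF that]]
    by simp
  have "(\<lambda>h. \<lambda>k\<in>{..<m}. \<Sum>l<state_dim G. E t $$ (k, l) * h t $ l)
      \<in> measurable ?N (Pi\<^sub>M {..<m} (\<lambda>_. borel))"
    using comp by (intro measurable_restrict borel_measurable_sum borel_measurable_times) auto
  also have "?this \<longleftrightarrow> (\<lambda>h. \<lambda>k\<in>{..<m}. (E t *\<^sub>v h t) $ k) \<in> measurable ?N (Pi\<^sub>M {..<m} (\<lambda>_. borel))"
  proof (intro measurable_cong restrict_ext)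
    fix h k assume "h \<in> space ?N" "k \<in> {..<m}"
    then have "h t \<in> carrier_vec (state_dim G)" "k < m" by (auto simp: space_PiM PiE_def Pi_def)
    then show "(\<Sum>l<state_dim G. E t $$ (k, l) * h t $ l) = (E t *\<^sub>v h t) $ k"
      using E by (auto simp: scalar_prod_def atLeast0LessThan intro!: sum.cong)
  qed
  finally show "(\<lambda>h. E t *\<^sub>v h t) \<in> measurable ?N (vec_borel m)"
    unfolding vec_borel_def[of m]
    by (intro measurable_vimage_algebra2) (use E in \<open>auto intro!: carrier_vecI\<close>)
qed

lemma fun_upd_constant_policy:
  assumes "\<sigma> \<in> feedback_policies G m" "w \<in> carrier_vec m"
  shows "\<sigma>(t := \<lambda>_. w) \<in> feedback_policies G m"
  using assms by (auto simp: feedback_policies_def)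

lemma history_restrict: "h \<in> histories G x0 t \<Longrightarrow> restrict h {..t} = h"
  by (auto simp: histories_def PiE_def extensional_restrict)

lemma history_carrier: "h \<in> histories G x0 t \<Longrightarrow> h t \<in> carrier_vec (state_dim G)"
  by (auto simp: histories_def PiE_def Pi_def)

text \<open>The definition extends histories at the far end; backward induction needs to split off the first
  stage instead.\<close>

lemma worst_hist_Suc_left:
  "worst_hist G i \<pi> \<sigma> t h (Suc k)
    = worst_hist G i \<pi> \<sigma> (Suc t) (worst_hist G i \<pi> \<sigma> t h (Suc 0)) k"
proof (induction k)
  case 0
  show ?case
    by (rule ext) (auto simp: Let_def restrict_def le_Suc_eq)
next
  case (Suc k)
  show ?case
    unfolding worst_hist.simps(2)[of _ _ _ _ t h "Suc k"] worst_hist.simps(2)[of _ _ _ _ "Suc t" _ k] Suc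
    by (simp only: add_Suc_right add_Suc)
qed

lemma next_history:
  assumes "h \<in> histories G x0 t"
  shows "worst_hist G i \<pi> \<sigma> t h (Suc 0) \<in> histories G x0 (Suc t)"
    and "worst_hist G i \<pi> \<sigma> t h (Suc 0) (Suc t)
      = A_mat G t *\<^sub>v h t + B_mat G t i *\<^sub>v \<pi> i t h + B_others G t i *\<^sub>v \<sigma> t h"
proof -
  let ?x = "A_mat G t *\<^sub>v h t + B_mat G t i *\<^sub>v \<pi> i t h + B_others G t i *\<^sub>v \<sigma> t h"
  have w: "worst_hist G i \<pi> \<sigma> t h (Suc 0) = h(Suc t := ?x)"
    by (simp add: Let_def history_restrict[OF assms])
  then show "worst_hist G i \<pi> \<sigma> t h (Suc 0) (Suc t) = ?x" by simp
  have "?x \<in> carrier_vec (state_dim G)"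
    by (intro carrier_vecI) (simp add: B_others_def)
  then show "worst_hist G i \<pi> \<sigma> t h (Suc 0) \<in> histories G x0 (Suc t)"
    using assms unfolding w histories_def
    by (auto simp: PiE_def Pi_def extensional_def le_Suc_eq)
qed

lemma adv_payoff_horizon:
  "h \<in> histories G x0 (horizon G) \<Longrightarrow>
    adv_payoff G i \<pi> (horizon G) h \<sigma> = quad (Q_mat G (horizon G) i) (h (horizon G))"
  by (simp add: adv_payoff_def history_restrict)

lemma adv_payoff_step:
  assumes t: "t < horizon G" and h: "h \<in> histories G x0 t"
  shows "adv_payoff G i \<pi> t h \<sigma>
    = stage_cost G i \<pi> \<sigma> t h + adv_payoff G i \<pi> (Suc t) (worst_hist G i \<pi> \<sigma> t h (Suc 0)) \<sigma>"
proof -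
  let ?h = "worst_hist G i \<pi> \<sigma> t h (Suc 0)"
  have shift: "worst_hist G i \<pi> \<sigma> t h (s - t) = worst_hist G i \<pi> \<sigma> (Suc t) ?h (s - Suc t)" if "t < s" for s
    using worst_hist_Suc_left[of G i \<pi> \<sigma> t h "s - Suc t"] that by (simp add: Suc_diff_Suc del: worst_hist.simps)
  have "(\<Sum>s = t..<horizon G. stage_cost G i \<pi> \<sigma> s (worst_hist G i \<pi> \<sigma> t h (s - t)))
      = stage_cost G i \<pi> \<sigma> t (worst_hist G i \<pi> \<sigma> t h 0)
      + (\<Sum>s = Suc t..<horizon G. stage_cost G i \<pi> \<sigma> s (worst_hist G i \<pi> \<sigma> t h (s - t)))"
    using t by (simp add: sum.atLeast_Suc_lessThan del: worst_hist.simps)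
  also have "(\<Sum>s = Suc t..<horizon G. stage_cost G i \<pi> \<sigma> s (worst_hist G i \<pi> \<sigma> t h (s - t)))
      = (\<Sum>s = Suc t..<horizon G. stage_cost G i \<pi> \<sigma> s (worst_hist G i \<pi> \<sigma> (Suc t) ?h (s - Suc t)))"
    using shift by (intro sum.cong) auto
  finally show ?thesis
    unfolding adv_payoff_def shift[OF t] worst_hist.simps(1) history_restrict[OF h] by simp
qed

section \<open>The saddle property of the Riccati gains over the remaining stages\<close>

context riccati_game
begin

text \<open>Agreement with the gains is demanded only at histories that start in \<open>x0\<close>, because the subgame
  perfect equilibria of the game constrain policies nowhere else. All histories that arise from such
  a history are again of this kind.\<close>

definition follows_gains :: "real vec \<Rightarrow> nat \<Rightarrow> nat \<Rightarrow> policy \<Rightarrow> bool" where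
  "follows_gains x0 t j \<rho> \<longleftrightarrow>
    (\<forall>s y. t \<le> s \<longrightarrow> s < horizon G \<longrightarrow> y \<in> histories G x0 s \<longrightarrow> \<rho> s y = K_policy G j s y)"

lemma follows_gainsD:
  "follows_gains x0 t j \<rho> \<Longrightarrow> t \<le> s \<Longrightarrow> s < horizon G \<Longrightarrow> y \<in> histories G x0 s \<Longrightarrow> \<rho> s y = K_policy G j s y"
  by (simp add: follows_gains_def)

lemma follows_gains_mono: "follows_gains x0 t j \<rho> \<Longrightarrow> t \<le> t' \<Longrightarrow> follows_gains x0 t' j \<rho>"
  by (auto simp: follows_gains_def)

lemma follows_gains_K_policy: "follows_gains x0 t j (K_policy G j)"
  by (simp add: follows_gains_def)

lemma stage_cost_plus_value:
  assumes "h \<in> histories G x0 t" and t: "t < horizon G" and i: "i < players G"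
  shows "stage_cost G i \<pi> \<sigma> t h + quad (P_mat G (Suc t) i) (worst_hist G i \<pi> \<sigma> t h (Suc 0) (Suc t))
    = game_val t i (h t) (others_input G i \<pi> t h) (\<pi> i t h) (\<sigma> t h)"
proof -
  interpret saddle_stage_game "state_dim G" "input_dim G i" "adv_dim G i" "A_mat G t" "B_mat G t i"
    "B_others G t i" "Q_mat G t i" "R_mat G t i" "S_mat G t i" "M_mat G t i" "P_mat G (Suc t) i"
    by (rule stage_game[OF t i])
  show ?thesis
    unfolding next_history(2)[OF assms(1)] stage_cost_def stage_val_def step_def ..
qed

lemma others_input_follows_gains:
  assumes "h \<in> histories G x0 t" "t < horizon G"
    and "\<And>j. j < players G \<Longrightarrow> j \<noteq> i \<Longrightarrow> follows_gains x0 t j (\<pi> j)"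
  shows "others_input G i \<pi> t h = K_others_of G t (P_mat G (Suc t)) i *\<^sub>v h t"
  unfolding others_input_def K_others_mult
  using assms follows_gainsD[OF assms(3), of _ t h]
  by (intro arg_cong[of _ _ vstack_vec] map_cong) (auto simp: K_policy_def K_mat_def)

text \<open>The upper half of the saddle property, summed over the stages by telescoping of the values. Each
  stage loses a positive amount unless the adversary plays \<open>L\<close>, whence the equality case. The
  two claims are proved together since the equality case of a stage needs the bound for the later
  ones.\<close>

lemma payoff_le_value:
  assumes i: "i < players G" and \<sigma>: "\<sigma> \<in> adv_policies G i"
    and "t \<le> horizon G" "h \<in> histories G x0 t"
    and "\<And>j. j < players G \<Longrightarrow> follows_gains x0 t j (\<pi> j)"
  shows "adv_payoff G i \<pi> t h \<sigma> \<le> quad (P_mat G t i) (h t) \<and>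
    (adv_payoff G i \<pi> t h \<sigma> = quad (P_mat G t i) (h t) \<longrightarrow>
      (\<forall>s\<in>{t..<horizon G}. \<sigma> s (worst_hist G i \<pi> \<sigma> t h (s - t))
         = L_policy G i s (worst_hist G i \<pi> \<sigma> t h (s - t))))"
  using assms(3-)
proof (induction arbitrary: h rule: inc_induct)
  case base
  then show ?case by (simp add: adv_payoff_horizon P_mat_horizon)
next
  case (step t)
  note t = \<open>t < horizon G\<close> and h = \<open>h \<in> histories G x0 t\<close>
  interpret saddle_stage_game "state_dim G" "input_dim G i" "adv_dim G i" "A_mat G t" "B_mat G t i"
    "B_others G t i" "Q_mat G t i" "R_mat G t i" "S_mat G t i" "M_mat G t i" "P_mat G (Suc t) i"
    by (rule stage_game[OF t i])
  let ?h = "worst_hist G i \<pi> \<sigma> t h (Suc 0)" and ?x = "h t"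
  let ?v = "K_others_of G t (P_mat G (Suc t)) i *\<^sub>v ?x" and ?u = "K_mat G t i *\<^sub>v ?x"
    and ?d = "L_mat G t i *\<^sub>v ?x"
  have x: "?x \<in> carrier_vec (state_dim G)" by (rule history_carrier[OF h])
  have c: "?v \<in> carrier_vec (adv_dim G i)" "?u \<in> carrier_vec (input_dim G i)" "?d \<in> carrier_vec (adv_dim G i)"
    unfolding K_mat_def L_mat_def
    using mult_mat_vec_carrier[OF K_L_carrier(1) x] mult_mat_vec_carrier[OF K_L_carrier(2) x]
      mult_mat_vec_carrier[OF K_others_carrier x] by auto
  have \<sigma>c: "\<sigma> t h \<in> carrier_vec (adv_dim G i)"
    using policy_value_carrier[OF _ t h] \<sigma> by (simp add: adv_policies_def)
  have IH: "adv_payoff G i \<pi> (Suc t) ?h \<sigma> \<le> quad (P_mat G (Suc t) i) (?h (Suc t))"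
    "adv_payoff G i \<pi> (Suc t) ?h \<sigma> = quad (P_mat G (Suc t) i) (?h (Suc t)) \<Longrightarrow>
      s \<in> {Suc t..<horizon G} \<Longrightarrow> \<sigma> s (worst_hist G i \<pi> \<sigma> (Suc t) ?h (s - Suc t))
         = L_policy G i s (worst_hist G i \<pi> \<sigma> (Suc t) ?h (s - Suc t))" for s
    using step.IH[OF next_history(1)[OF h] follows_gains_mono[OF step.prems(2)], of i \<pi> \<sigma>]
    by (auto simp del: worst_hist.simps)
  have inputs: "others_input G i \<pi> t h = ?v" "\<pi> i t h = ?u"
    using others_input_follows_gains[OF h t step.prems(2)] follows_gainsD[OF step.prems(2)[OF i] order_refl t h]
    by (auto simp: K_policy_def)
  have payoff: "adv_payoff G i \<pi> t h \<sigma> = game_val t i ?x ?v ?u (\<sigma> t h)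
      + (adv_payoff G i \<pi> (Suc t) ?h \<sigma> - quad (P_mat G (Suc t) i) (?h (Suc t)))"
    using adv_payoff_step[OF t h, of i \<pi> \<sigma>] stage_cost_plus_value[OF h t i, of \<pi> \<sigma>]
    unfolding inputs by simp
  note le = deviate_d_le[OF x c(2,1,3) \<sigma>c gains_stationary(2)[OF t i x]]
  note val = riccati_value[OF t i x]
  have "adv_payoff G i \<pi> t h \<sigma> \<le> quad (P_mat G t i) ?x"
    using payoff le(1) IH(1) val by linarith
  moreover have "\<sigma> s (worst_hist G i \<pi> \<sigma> t h (s - t)) = L_policy G i s (worst_hist G i \<pi> \<sigma> t h (s - t))"
    if eq: "adv_payoff G i \<pi> t h \<sigma> = quad (P_mat G t i) ?x" and s: "s \<in> {t..<horizon G}" for s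
  proof (cases "s = t")
    case True
    have "\<sigma> t h = ?d"
      using payoff le(1) IH(1) val eq by (intro le(2)) linarith
    then show ?thesis
      using True by (simp add: history_restrict[OF h] L_policy_def)
  next
    case False
    have "adv_payoff G i \<pi> (Suc t) ?h \<sigma> = quad (P_mat G (Suc t) i) (?h (Suc t))"
      using payoff le(1) IH(1) val eq by linarith
    moreover have "worst_hist G i \<pi> \<sigma> t h (s - t) = worst_hist G i \<pi> \<sigma> (Suc t) ?h (s - Suc t)"
      using worst_hist_Suc_left[of G i \<pi> \<sigma> t h "s - Suc t"] False s
      by (simp add: Suc_diff_Suc del: worst_hist.simps)
    ultimately show ?thesis using IH(2)[of s] False s by simp
  qed
  ultimately show ?case by blast
qed

text \<open>The lower half of the saddle property: it suffices to exhibit the adversary \<open>L\<close>, whatever player \<open>i\<close>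
  does.\<close>

lemma payoff_ge_value:
  assumes i: "i < players G" and \<rho>: "\<pi> i \<in> policies G i"
    and \<sigma>: "\<And>s y. t \<le> s \<Longrightarrow> s < horizon G \<Longrightarrow> y \<in> histories G x0 s \<Longrightarrow> \<sigma> s y = L_policy G i s y"
    and others: "\<And>j. j < players G \<Longrightarrow> j \<noteq> i \<Longrightarrow> follows_gains x0 t j (\<pi> j)"
    and "t \<le> horizon G" "h \<in> histories G x0 t"
  shows "quad (P_mat G t i) (h t) \<le> adv_payoff G i \<pi> t h \<sigma>"
  using assms(5,6) \<sigma> others
proof (induction arbitrary: h rule: inc_induct)
  case base
  then show ?case by (simp add: adv_payoff_horizon P_mat_horizon)
next
  case (step t)
  note t = \<open>t < horizon G\<close> and h = \<open>h \<in> histories G x0 t\<close>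
  interpret saddle_stage_game "state_dim G" "input_dim G i" "adv_dim G i" "A_mat G t" "B_mat G t i"
    "B_others G t i" "Q_mat G t i" "R_mat G t i" "S_mat G t i" "M_mat G t i" "P_mat G (Suc t) i"
    by (rule stage_game[OF t i])
  let ?h = "worst_hist G i \<pi> \<sigma> t h (Suc 0)" and ?x = "h t"
  let ?v = "K_others_of G t (P_mat G (Suc t)) i *\<^sub>v ?x" and ?u = "K_mat G t i *\<^sub>v ?x"
    and ?d = "L_mat G t i *\<^sub>v ?x"
  have x: "?x \<in> carrier_vec (state_dim G)" by (rule history_carrier[OF h])
  have c: "?v \<in> carrier_vec (adv_dim G i)" "?u \<in> carrier_vec (input_dim G i)" "?d \<in> carrier_vec (adv_dim G i)"
    unfolding K_mat_def L_mat_def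
    using mult_mat_vec_carrier[OF K_L_carrier(1) x] mult_mat_vec_carrier[OF K_L_carrier(2) x]
      mult_mat_vec_carrier[OF K_others_carrier x] by auto
  have \<rho>c: "\<pi> i t h \<in> carrier_vec (input_dim G i)"
    using policy_value_carrier[OF _ t h] \<rho> by (simp add: policies_def)
  have IH: "quad (P_mat G (Suc t) i) (?h (Suc t)) \<le> adv_payoff G i \<pi> (Suc t) ?h \<sigma>"
    using step.prems by (intro step.IH next_history(1)[OF h]) (auto intro: follows_gains_mono[OF _ le_SucI[OF order_refl]])
  have inputs: "others_input G i \<pi> t h = ?v" "\<sigma> t h = ?d"
    using others_input_follows_gains[OF h t step.prems(3)] step.prems(2)[OF order_refl t h]
    by (auto simp: L_policy_def)
  have "quad (P_mat G t i) ?x \<le> game_val t i ?x ?v (\<pi> i t h) ?d"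
    unfolding riccati_value[OF t i x]
    by (rule deviate_u_ge[OF x c(2) \<rho>c c(1,3) gains_stationary(2,1)[OF t i x]])
  also have "\<dots> = stage_cost G i \<pi> \<sigma> t h + quad (P_mat G (Suc t) i) (?h (Suc t))"
    using stage_cost_plus_value[OF h t i, of \<pi> \<sigma>] unfolding inputs by simp
  also have "\<dots> \<le> adv_payoff G i \<pi> t h \<sigma>"
    using IH adv_payoff_step[OF t h, of i \<pi> \<sigma>] by simp
  finally show ?case .
qed

section \<open>Equilibrium and uniqueness\<close>

lemma K_policy_in_policies: "K_policy G i \<in> policies G i"
  unfolding policies_def K_policy_def[abs_def]
  by (rule linear_feedback_policy) (simp add: K_mat_def)

lemma L_policy_in_adv_policies: "L_policy G i \<in> adv_policies G i"
  unfolding adv_policies_def L_policy_def[abs_def]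
  by (rule linear_feedback_policy) (simp add: L_mat_def)

lemma payoff_L_policy:
  assumes "i < players G" "t \<le> horizon G" "h \<in> histories G x0 t"
  shows "adv_payoff G i (K_policy G) t h (L_policy G i) = quad (P_mat G t i) (h t)"
proof (rule antisym)
  show "adv_payoff G i (K_policy G) t h (L_policy G i) \<le> quad (P_mat G t i) (h t)"
    using payoff_le_value[OF assms(1) L_policy_in_adv_policies assms(2,3) follows_gains_K_policy] by simp
  show "quad (P_mat G t i) (h t) \<le> adv_payoff G i (K_policy G) t h (L_policy G i)"
    by (rule payoff_ge_value[OF assms(1) K_policy_in_policies _ follows_gains_K_policy assms(2,3)]) simp
qed

lemma optimal_adv_L_policy:
  assumes "i < players G" "t \<le> horizon G" "h \<in> histories G x0 t"
  shows "optimal_adv G i (K_policy G) t h (L_policy G i)"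
  unfolding optimal_adv_def is_arg_max_def payoff_L_policy[OF assms]
  using L_policy_in_adv_policies
    payoff_le_value[OF assms(1) _ assms(2,3) follows_gains_K_policy]
  by (force simp: not_less)

lemma optimal_adv_imp_L_policy:
  assumes "i < players G" "t \<le> horizon G" "h \<in> histories G x0 t"
    and opt: "optimal_adv G i (K_policy G) t h \<sigma>" and s: "s \<in> {t..<horizon G}"
  shows "\<sigma> s (worst_hist G i (K_policy G) \<sigma> t h (s - t))
    = L_policy G i s (worst_hist G i (K_policy G) \<sigma> t h (s - t))"
proof -
  have \<sigma>: "\<sigma> \<in> adv_policies G i"
    and "\<not> adv_payoff G i (K_policy G) t h \<sigma> < adv_payoff G i (K_policy G) t h (L_policy G i)"
    using opt L_policy_in_adv_policies unfolding optimal_adv_def is_arg_max_def by blast+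
  then have "quad (P_mat G t i) (h t) \<le> adv_payoff G i (K_policy G) t h \<sigma>"
    unfolding payoff_L_policy[OF assms(1-3)] by simp
  then show ?thesis
    using payoff_le_value[OF assms(1) \<sigma> assms(2,3) follows_gains_K_policy] s by (metis antisym)
qed

lemma equilibrium_after_K_policy:
  assumes "t \<le> horizon G" "h \<in> histories G x0 t"
  shows "equilibrium_after G t h (K_policy G)"
  unfolding equilibrium_after_def
proof (intro conjI allI impI ballI K_policy_in_policies)
  fix i \<rho> assume i: "i < players G" and \<rho>: "\<rho> \<in> policies G i"
  have "robust_cost G i (K_policy G) t h \<le> ereal (quad (P_mat G t i) (h t))"
    unfolding robust_cost_def
    using payoff_le_value[OF i _ assms follows_gains_K_policy] by (intro SUP_least) simp
  \<comment> \<open>the robust cost of a deviation is bounded below by the single adversary \<open>L\<close>\<close>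
  also have "\<dots> \<le> ereal (adv_payoff G i ((K_policy G)(i := \<rho>)) t h (L_policy G i))"
    using \<rho> follows_gains_K_policy
    by (intro ereal_less_eq(3)[THEN iffD2] payoff_ge_value[OF i _ _ _ assms]) auto
  also have "\<dots> \<le> robust_cost G i ((K_policy G)(i := \<rho>)) t h"
    unfolding robust_cost_def by (intro SUP_upper L_policy_in_adv_policies)
  finally show "robust_cost G i (K_policy G) t h \<le> robust_cost G i ((K_policy G)(i := \<rho>)) t h" .
qed

text \<open>When the gains are used from the next stage on, an adversary can do no better than choose an
  arbitrary \<open>d\<close> now and play \<open>L\<close> afterwards, so the robust cost is the maximum of the stage payoff
  over \<open>d\<close>, attained at the stationary point.\<close>

lemma robust_cost_one_stage:
  assumes t: "t < horizon G" and i: "i < players G" and h: "h \<in> histories G x0 t"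
    and \<pi>: "\<pi> i \<in> policies G i"
    and later: "\<And>j. j < players G \<Longrightarrow> follows_gains x0 (Suc t) j (\<pi> j)"
    and v: "others_input G i \<pi> t h \<in> carrier_vec (adv_dim G i)"
    and d: "d \<in> carrier_vec (adv_dim G i)"
      "game_stationary_d t i (h t) (others_input G i \<pi> t h) (\<pi> i t h) d"
  shows "robust_cost G i \<pi> t h
    = ereal (game_val t i (h t) (others_input G i \<pi> t h) (\<pi> i t h) d)"
proof (rule antisym)
  interpret saddle_stage_game "state_dim G" "input_dim G i" "adv_dim G i" "A_mat G t" "B_mat G t i"
    "B_others G t i" "Q_mat G t i" "R_mat G t i" "S_mat G t i" "M_mat G t i" "P_mat G (Suc t) i"
    by (rule stage_game[OF t i])
  have x: "h t \<in> carrier_vec (state_dim G)" by (rule history_carrier[OF h])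
  have u: "\<pi> i t h \<in> carrier_vec (input_dim G i)"
    using policy_value_carrier[OF _ t h] \<pi> by (simp add: policies_def)
  let ?val = "game_val t i (h t) (others_input G i \<pi> t h) (\<pi> i t h)"
  let ?next = "\<lambda>\<sigma>. worst_hist G i \<pi> \<sigma> t h (Suc 0)"
  have payoff: "adv_payoff G i \<pi> t h \<sigma> = ?val (\<sigma> t h)
      + (adv_payoff G i \<pi> (Suc t) (?next \<sigma>) \<sigma> - quad (P_mat G (Suc t) i) (?next \<sigma> (Suc t)))" for \<sigma>
    using adv_payoff_step[OF t h, of i \<pi> \<sigma>] stage_cost_plus_value[OF h t i, of \<pi> \<sigma>] by simp
  have le: "adv_payoff G i \<pi> (Suc t) (?next \<sigma>) \<sigma> \<le> quad (P_mat G (Suc t) i) (?next \<sigma> (Suc t))"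
    if "\<sigma> \<in> adv_policies G i" for \<sigma>
    using payoff_le_value[OF i that _ next_history(1)[OF h] later] t by simp
  show "robust_cost G i \<pi> t h \<le> ereal (?val d)"
    unfolding robust_cost_def
  proof (rule SUP_least)
    fix \<sigma> assume \<sigma>: "\<sigma> \<in> adv_policies G i"
    then have "\<sigma> t h \<in> carrier_vec (adv_dim G i)"
      using policy_value_carrier[OF _ t h] by (simp add: adv_policies_def)
    then have "?val (\<sigma> t h) \<le> ?val d"
      by (rule deviate_d_le(1)[OF x u v d(1) _ d(2)])
    then show "ereal (adv_payoff G i \<pi> t h \<sigma>) \<le> ereal (?val d)"
      using payoff[of \<sigma>] le[OF \<sigma>] by simp
  qed
  \<comment> \<open>only the history \<open>h\<close> matters at time \<open>t\<close>, so a constant there suffices and is measurable\<close>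
  let ?\<sigma> = "(L_policy G i)(t := \<lambda>_. d)"
  have \<sigma>: "?\<sigma> \<in> adv_policies G i"
    using L_policy_in_adv_policies d(1) by (simp add: adv_policies_def fun_upd_constant_policy)
  have "quad (P_mat G (Suc t) i) (?next ?\<sigma> (Suc t)) \<le> adv_payoff G i \<pi> (Suc t) (?next ?\<sigma>) ?\<sigma>"
    using t by (intro payoff_ge_value[OF i \<pi> _ later _ next_history(1)[OF h]]) auto
  then have "ereal (?val d) \<le> ereal (adv_payoff G i \<pi> t h ?\<sigma>)"
    using payoff[of ?\<sigma>] by simp
  also have "\<dots> \<le> robust_cost G i \<pi> t h"
    unfolding robust_cost_def by (intro SUP_upper \<sigma>)
  finally show "ereal (?val d) \<le> robust_cost G i \<pi> t h" .
qed

text \<open>Backward induction on \<open>t\<close>. The inputs prescribed at a history at time \<open>t\<close> are compared with constant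
  deviations at that time only; the minimality of all players makes all stationarity conditions hold
  at once, and their only solution is given by the gains.\<close>

lemma subgame_perfect_follows_gains:
  assumes sp: "subgame_perfect G x0 \<pi>" and x0: "x0 \<in> carrier_vec (state_dim G)"
    and "t \<le> horizon G" and "i < players G"
  shows "follows_gains x0 t i (\<pi> i)"
proof -
  have "equilibrium_after G 0 (initial_history x0) \<pi>"
    using sp x0 by (auto simp: subgame_perfect_def histories_def initial_history_def)
  then have \<pi>: "\<pi> i \<in> policies G i" if "i < players G" for i
    using that by (simp add: equilibrium_after_def)
  have "\<forall>i<players G. follows_gains x0 t i (\<pi> i)"
    using \<open>t \<le> horizon G\<close>
  proof (induction rule: inc_induct)
    case base
    show ?case by (simp add: follows_gains_def)
  next
    case (step t)
    note t = \<open>t < horizon G\<close>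
    have later: "follows_gains x0 (Suc t) j (\<pi> j)" if "j < players G" for j
      using step.IH that by blast
    have now: "\<pi> i t h = K_policy G i t h" if i: "i < players G" and h: "h \<in> histories G x0 t" for i h
    proof -
      let ?x = "h t" and ?u = "\<lambda>j. \<pi> j t h" and ?v = "\<lambda>j. others_input G j \<pi> t h"
      have x: "?x \<in> carrier_vec (state_dim G)" by (rule history_carrier[OF h])
      have u: "?u j \<in> carrier_vec (input_dim G j)" if "j < players G" for j
        using policy_value_carrier[OF _ t h] \<pi>[OF that] by (simp add: policies_def)
      have v: "?v j \<in> carrier_vec (adv_dim G j)" for j
      proof (rule carrier_vecI)
        have "(\<Sum>k\<leftarrow>others G j. dim_vec (?u k)) = (\<Sum>k\<leftarrow>others G j. input_dim G k)"
          using carrier_vecD[OF u] by (intro arg_cong[of _ _ sum_list] map_cong) auto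
        then show "dim_vec (?v j) = adv_dim G j"
          by (simp add: others_input_def adv_dim_eq_sum_list comp_def)
      qed
      have "\<exists>d. d \<in> carrier_vec (adv_dim G j) \<and> game_stationary_d t j ?x (?v j) (?u j) d"
        if j: "j < players G" for j
        using saddle_stage_game.ex_stationary_d[OF stage_game[OF t j] x u[OF j] v[of j]] by blast
      then obtain d where d: "\<And>j. j < players G \<Longrightarrow> d j \<in> carrier_vec (adv_dim G j)"
        "\<And>j. j < players G \<Longrightarrow> game_stationary_d t j ?x (?v j) (?u j) (d j)"
        by metis
      have su: "game_stationary_u t j ?x (?u j) (d j)" if j: "j < players G" for j
      proof (rule saddle_stage_game.minimax_imp_stationary_u[OF stage_game[OF t j] x u[OF j] v[of j] d(1,2)[OF j]])
        fix u' d' assume u': "u' \<in> carrier_vec (input_dim G j)" and d': "d' \<in> carrier_vec (adv_dim G j)"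
          "game_stationary_d t j ?x (?v j) u' d'"
        let ?\<rho> = "(\<pi> j)(t := \<lambda>_. u')"
        let ?\<pi> = "\<pi>(j := ?\<rho>)"
        have \<rho>: "?\<rho> \<in> policies G j"
          using \<pi>[OF j] u' by (simp add: policies_def fun_upd_constant_policy)
        have v': "others_input G j ?\<pi> t h = ?v j"
          unfolding others_input_def by (intro arg_cong[of _ _ vstack_vec] map_cong) auto
        have "equilibrium_after G t h \<pi>"
          using sp t h by (simp add: subgame_perfect_def)
        then have "robust_cost G j \<pi> t h \<le> robust_cost G j ?\<pi> t h"
          using j \<rho> by (simp add: equilibrium_after_def)
        also have "robust_cost G j ?\<pi> t h = ereal (game_val t j ?x (?v j) u' d')"
        proof -
          have "follows_gains x0 (Suc t) k (?\<pi> k)" if "k < players G" for k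
            using later[OF that] later[OF j] by (auto simp: follows_gains_def)
          then show ?thesis
            using robust_cost_one_stage[OF t j h, of ?\<pi> d'] \<rho> v[of j] d' unfolding v' by simp
        qed
        also have "robust_cost G j \<pi> t h = ereal (game_val t j ?x (?v j) (?u j) (d j))"
          by (rule robust_cost_one_stage[OF t j h \<pi>[OF j] later v d(1,2)[OF j]])
        finally show "game_val t j ?x (?v j) (?u j) (d j) \<le> game_val t j ?x (?v j) u' d'" by simp
      qed
      have "?u i = K_mat G t i *\<^sub>v ?x"
        by (rule stationary_imp_gain[OF t i x u d(1) su d(2)[unfolded others_input_def]])
      then show ?thesis by (simp add: K_policy_def)
    qed
    show ?case
      unfolding follows_gains_def
    proof (intro allI impI)
      fix i s y assume i: "i < players G" and s: "t \<le> s" "s < horizon G" and y: "y \<in> histories G x0 s"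
      show "\<pi> i s y = K_policy G i s y"
        using now[OF i] follows_gainsD[OF later[OF i] _ s(2) y] s y by (cases "s = t") auto
    qed
  qed
  then show ?thesis using assms(4) by blast
qed

end

theorem theorem1:
  fixes G :: lq_game and x0 :: "real vec"
  assumes "well_formed G"
    and "x0 \<in> carrier_vec (state_dim G)"
    and "\<And>t i. t < horizon G \<Longrightarrow> i < players G \<Longrightarrow>
           pos_def (input_dim G i) (H_uu G t (P_mat G (Suc t)) i)"
    and "\<And>t i. t < horizon G \<Longrightarrow> i < players G \<Longrightarrow>
           pos_def (adv_dim G i) (H_dd G t (P_mat G (Suc t)) i)"
    and "\<And>t. t < horizon G \<Longrightarrow> invertible_mat (H_mat G t (P_mat G (Suc t)))"
  shows "equilibrium G x0 (K_policy G) \<and>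
    subgame_perfect G x0 (K_policy G) \<and>
    (\<forall>\<pi>. subgame_perfect G x0 \<pi> \<longrightarrow>
       (\<forall>i<players G. \<forall>t<horizon G. \<forall>h\<in>histories G x0 t. \<pi> i t h = K_policy G i t h)) \<and>
    (\<forall>i<players G.
       optimal_adv G i (K_policy G) 0 (initial_history x0) (L_policy G i) \<and>
       (\<forall>t<horizon G. \<forall>h\<in>histories G x0 t. optimal_adv G i (K_policy G) t h (L_policy G i)) \<and>
       (\<forall>t<horizon G. \<forall>h\<in>histories G x0 t. \<forall>\<sigma>. optimal_adv G i (K_policy G) t h \<sigma> \<longrightarrow>
          (\<forall>s\<in>{t..<horizon G}. let y = worst_hist G i (K_policy G) \<sigma> t h (s - t) in
             \<sigma> s y = L_policy G i s y)) \<and>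
       (\<forall>\<sigma>. (\<forall>t<horizon G. \<forall>h\<in>histories G x0 t. optimal_adv G i (K_policy G) t h \<sigma>) \<longrightarrow>
          (\<forall>t<horizon G. \<forall>h\<in>histories G x0 t. \<sigma> t h = L_policy G i t h)))"
proof -
  interpret riccati_game G
    using assms by unfold_locales
  have init: "initial_history x0 \<in> histories G x0 0"
    using assms(2) by (auto simp: histories_def initial_history_def)
  show ?thesis
  proof (intro conjI allI impI ballI)
    show "equilibrium G x0 (K_policy G)"
      unfolding equilibrium_def by (rule equilibrium_after_K_policy[OF _ init]) simp
    show "subgame_perfect G x0 (K_policy G)"
      unfolding subgame_perfect_def using equilibrium_after_K_policy by blast
  next
    fix \<pi> i t h
    assume "subgame_perfect G x0 \<pi>" "i < players G" "t < horizon G" "h \<in> histories G x0 t"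
    then show "\<pi> i t h = K_policy G i t h"
      using subgame_perfect_follows_gains[OF _ assms(2), of \<pi> 0 i] follows_gainsD by blast
  next
    fix i assume i: "i < players G"
    show "optimal_adv G i (K_policy G) 0 (initial_history x0) (L_policy G i)"
      by (rule optimal_adv_L_policy[OF i _ init]) simp
    show "optimal_adv G i (K_policy G) t h (L_policy G i)"
      if "t < horizon G" "h \<in> histories G x0 t" for t h
      using optimal_adv_L_policy[OF i _ that(2)] that(1) by simp
    show "let y = worst_hist G i (K_policy G) \<sigma> t h (s - t) in \<sigma> s y = L_policy G i s y"
      if "t < horizon G" "h \<in> histories G x0 t" "optimal_adv G i (K_policy G) t h \<sigma>"
        "s \<in> {t..<horizon G}" for t h \<sigma> s
      unfolding Let_def using optimal_adv_imp_L_policy[OF i _ that(2-4)] that(1) by simp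
    show "\<sigma> t h = L_policy G i t h"
      if "\<forall>t<horizon G. \<forall>h\<in>histories G x0 t. optimal_adv G i (K_policy G) t h \<sigma>"
        "t < horizon G" "h \<in> histories G x0 t" for \<sigma> t h
      using optimal_adv_imp_L_policy[OF i _ that(3), of \<sigma> t] that
      by (simp add: history_restrict[OF that(3)])
  qed
qed

end
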